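(* For every integer $k \ge 2$ there exists a constant $\varepsilon_k > 0$ such that the $k$-Orthogonal Vectors problem can be solved by a deterministic algorithm in time $\mathcal{O}(2^{(1-\varepsilon_k)d} \cdot n)$.
   Context: The $k$-Orthogonal Vectors problem: given families $A_1,\ldots,A_k$ of subsets of $\{1,\ldots,d\}$, each of size $n$, decide whether there exist $a_1\in A_1,\ldots,a_k\in A_k$ with $a_1\cap a_2\cap\cdots\cap a_k=\emptyset$. Throughout, $d = c\log n$ for some constant $c>0$. *)

theory Defs
  imports Complex_Main
begin

text \<open>
  Deterministic word RAM with word length \<open>w\<close>: registers and memory cells hold natural numbers
  below \<open>2 ^ w\<close>, every result is truncated to \<open>w\<close> bits, and memory is addressed by register
  contents. Control flow is structured; each elementary instruction and each evaluation of a
  branch or loop condition costs one time unit.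
\<close>

datatype word_op = Add | Sub | Mul | Div | Mod | And | Or | Xor | Shl | Shr

datatype cmp_op = Lt | Le | Eq | Ne

datatype prog =
    Skip
  | Const nat nat
  | BinOp word_op nat nat nat
  | Load nat nat
  | Store nat nat
  | Seq prog prog
  | Branch cmp_op nat nat prog prog
  | While cmp_op nat nat prog

record state =
  reg :: "nat \<Rightarrow> nat"
  mem :: "nat \<Rightarrow> nat"

text \<open>Adding \<open>2 ^ w\<close> before subtracting makes \<open>Sub\<close> wrap around modulo \<open>2 ^ w\<close> instead of being
  cut off at zero.\<close>

fun word_op_val :: "nat \<Rightarrow> word_op \<Rightarrow> nat \<Rightarrow> nat \<Rightarrow> nat" where
  "word_op_val w Add x y = (x + y) mod 2 ^ w"
| "word_op_val w Sub x y = (x + 2 ^ w - y) mod 2 ^ w"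
| "word_op_val w Mul x y = (x * y) mod 2 ^ w"
| "word_op_val w Div x y = (x div y) mod 2 ^ w"
| "word_op_val w Mod x y = (x mod y) mod 2 ^ w"
| "word_op_val w And x y = (and x y) mod 2 ^ w"
| "word_op_val w Or x y = (or x y) mod 2 ^ w"
| "word_op_val w Xor x y = (xor x y) mod 2 ^ w"
| "word_op_val w Shl x y = (push_bit y x) mod 2 ^ w"
| "word_op_val w Shr x y = (drop_bit y x) mod 2 ^ w"

fun cmp_val :: "cmp_op \<Rightarrow> nat \<Rightarrow> nat \<Rightarrow> bool" where
  "cmp_val Lt x y \<longleftrightarrow> x < y"
| "cmp_val Le x y \<longleftrightarrow> x \<le> y"
| "cmp_val Eq x y \<longleftrightarrow> x = y"
| "cmp_val Ne x y \<longleftrightarrow> x \<noteq> y"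

text \<open>\<open>exec w p s t s'\<close>: started in \<open>s\<close>, program \<open>p\<close> halts in state \<open>s'\<close> after exactly \<open>t\<close> time units.\<close>

inductive exec :: "nat \<Rightarrow> prog \<Rightarrow> state \<Rightarrow> nat \<Rightarrow> state \<Rightarrow> bool" for w :: nat where
  exec_Skip: "exec w Skip s 0 s"
| exec_Const: "exec w (Const r v) s 1 (s\<lparr>reg := (reg s)(r := v mod 2 ^ w)\<rparr>)"
| exec_BinOp: "exec w (BinOp f r x y) s 1
     (s\<lparr>reg := (reg s)(r := word_op_val w f (reg s x) (reg s y))\<rparr>)"
| exec_Load: "exec w (Load r x) s 1 (s\<lparr>reg := (reg s)(r := mem s (reg s x))\<rparr>)"
| exec_Store: "exec w (Store x r) s 1 (s\<lparr>mem := (mem s)(reg s x := reg s r)\<rparr>)"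
| exec_Seq: "exec w p s t s' \<Longrightarrow> exec w q s' u s'' \<Longrightarrow> exec w (Seq p q) s (t + u) s''"
| exec_BranchTrue: "cmp_val f (reg s x) (reg s y) \<Longrightarrow> exec w p s t s' \<Longrightarrow>
     exec w (Branch f x y p q) s (Suc t) s'"
| exec_BranchFalse: "\<not> cmp_val f (reg s x) (reg s y) \<Longrightarrow> exec w q s t s' \<Longrightarrow>
     exec w (Branch f x y p q) s (Suc t) s'"
| exec_WhileFalse: "\<not> cmp_val f (reg s x) (reg s y) \<Longrightarrow> exec w (While f x y p) s 1 s"
| exec_WhileTrue: "cmp_val f (reg s x) (reg s y) \<Longrightarrow> exec w p s t s' \<Longrightarrow>
     exec w (While f x y p) s' u s'' \<Longrightarrow> exec w (While f x y p) s (Suc (t + u)) s''"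

inductive_cases exec_SkipE: "exec w Skip s t s'"
inductive_cases exec_ConstE: "exec w (Const r v) s t s'"
inductive_cases exec_BinOpE: "exec w (BinOp f r x y) s t s'"
inductive_cases exec_LoadE: "exec w (Load r x) s t s'"
inductive_cases exec_StoreE: "exec w (Store x r) s t s'"
inductive_cases exec_SeqE: "exec w (Seq p q) s t s'"
inductive_cases exec_BranchE: "exec w (Branch f x y p q) s t s'"
inductive_cases exec_WhileE: "exec w (While f x y p) s t s'"

lemma exec_deterministic:
  "exec w p s t s' \<Longrightarrow> exec w p s u s'' \<Longrightarrow> u = t \<and> s'' = s'"
proof (induction arbitrary: u s'' rule: exec.induct)
  case exec_Skip
  then show ?case by (rule exec_SkipE) simp
next
  case exec_Const
  then show ?case by (rule exec_ConstE) simp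
next
  case exec_BinOp
  then show ?case by (rule exec_BinOpE) simp
next
  case exec_Load
  then show ?case by (rule exec_LoadE) simp
next
  case exec_Store
  then show ?case by (rule exec_StoreE) simp
next
  case exec_Seq
  from exec_Seq.prems show ?case
    by (rule exec_SeqE) (use exec_Seq.IH in blast)
next
  case exec_BranchTrue
  from exec_BranchTrue.prems show ?case
    by (rule exec_BranchE) (use exec_BranchTrue.hyps exec_BranchTrue.IH in blast)+
next
  case exec_BranchFalse
  from exec_BranchFalse.prems show ?case
    by (rule exec_BranchE) (use exec_BranchFalse.hyps exec_BranchFalse.IH in blast)+
next
  case exec_WhileFalse
  from exec_WhileFalse.prems show ?case
    by (rule exec_WhileE) (use exec_WhileFalse.hyps in simp_all)
next
  case exec_WhileTrue
  from exec_WhileTrue.prems show ?case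
    by (rule exec_WhileE) (use exec_WhileTrue.hyps exec_WhileTrue.IH in blast)+
qed

definition initial_state :: "nat list \<Rightarrow> state" where
  "initial_state xs = \<lparr>reg = (\<lambda>_. 0), mem = (\<lambda>a. if a < length xs then xs ! a else 0)\<rparr>"

text \<open>The answer of a decision algorithm is left in register 0.\<close>

definition decides_within :: "nat \<Rightarrow> prog \<Rightarrow> nat list \<Rightarrow> bool \<Rightarrow> real \<Rightarrow> bool" where
  "decides_within w p xs b T \<longleftrightarrow>
     (\<exists>t s. exec w p (initial_state xs) t s \<and> real t \<le> T \<and> reg s 0 = (if b then 1 else 0))"

definition kov_instance :: "nat \<Rightarrow> nat \<Rightarrow> nat \<Rightarrow> nat set list list \<Rightarrow> bool" where
  "kov_instance k n d As \<longleftrightarrow>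
     length As = k \<and> (\<forall>A \<in> set As. length A = n \<and> (\<forall>a \<in> set A. a \<subseteq> {1..d}))"

definition kov_yes :: "nat set list list \<Rightarrow> bool" where
  "kov_yes As \<longleftrightarrow>
     (\<exists>a. (\<forall>i < length As. a i \<in> set (As ! i)) \<and> (\<Inter>i < length As. a i) = {})"

text \<open>Input layout: \<open>n\<close>, \<open>d\<close>, then the characteristic vectors of all sets, one coordinate per cell.\<close>

definition kov_encode :: "nat \<Rightarrow> nat \<Rightarrow> nat set list list \<Rightarrow> nat list" where
  "kov_encode n d As = n # d # [if x \<in> a then 1 else 0. A \<leftarrow> As, a \<leftarrow> A, x \<leftarrow> [1..<Suc d]]"

end

theory Submission imports Defs "HOL-Library.FuncSet" begin

text \<open>
  Two elementary algorithms suffice. Trying all tuples costs about \<open>n ^ k\<close>. Counting the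
  orthogonal tuples by inclusion-exclusion, as the sum of \<open>(-1) ^ |S| * (\<Prod>i<k. f i S)\<close> over all
  \<open>S\<close>, where \<open>f i S\<close> is the number of supersets of \<open>S\<close> in the \<open>i\<close>-th family, costs about
  \<open>2 ^ d + n\<close>, because the zeta transform computes all the \<open>f i S\<close> at once. If \<open>2 ^ d \<le> n ^ k\<close> then
  \<open>2 ^ d = 2 ^ ((1 - 1/k) d) * 2 ^ (d/k) \<le> 2 ^ ((1 - 1/k) d) * n\<close>, and otherwise
  \<open>n ^ k = n * n ^ (k - 1) \<le> n * 2 ^ ((1 - 1/k) d)\<close>. Hence running the cheaper algorithm achieves the
  exponent \<open>1 - 1/k\<close> up to a factor linear in \<open>d\<close>, which the choice \<open>\<epsilon> = 1/(2k)\<close> absorbs.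
\<close>

subsection \<open>Timed weakest preconditions\<close>

text \<open>What the overview leaves open is the word length. Since \<open>d\<close> is about
  \<open>c * log n\<close>, the largest numbers that occur, such as the signed sums up to
  \<open>n ^ k * 2 ^ d\<close>, are polynomial in \<open>n\<close>, so words of O(log n) bits hold
  them and all arithmetic is exact. The program depends on \<open>k\<close> alone: the cheaper
  algorithm is chosen at run time, and \<open>c\<close> influences only the required word length.
  The linear factor in \<open>d\<close> comes from the \<open>d\<close> rounds of the zeta transform
  and from the \<open>d\<close> coordinates of each vector or tuple. It is paid for with half of the
  saving \<open>1/k\<close>: \<open>d + 1\<close> is at most a constant times
  \<open>2 ^ (d/(2k))\<close>, and the other half remains as \<epsilon>.\<close>

definition wp :: "nat \<Rightarrow> prog \<Rightarrow> (nat \<Rightarrow> state \<Rightarrow> bool) \<Rightarrow> state \<Rightarrow> bool" where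
  "wp w p Q s \<longleftrightarrow> (\<exists>t s'. exec w p s t s' \<and> Q t s')"

lemma wp_mono: "wp w p Q s \<Longrightarrow> (\<And>t s'. Q t s' \<Longrightarrow> R t s') \<Longrightarrow> wp w p R s"
  unfolding wp_def by blast

text \<open>As equivalences, these rules let the simplifier execute straight-line code symbolically,
  with the elapsed time accumulating in the first argument of the postcondition.\<close>

lemma wp_Skip [simp]: "wp w Skip Q s \<longleftrightarrow> Q 0 s"
  unfolding wp_def by (auto intro: exec_Skip elim: exec_SkipE)

lemma wp_Const [simp]:
  "wp w (Const r v) Q s \<longleftrightarrow> Q 1 (s\<lparr>reg := (reg s)(r := v mod 2 ^ w)\<rparr>)"
  unfolding wp_def by (auto intro: exec_Const[simplified] elim!: exec_ConstE)

lemma wp_BinOp [simp]: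
  "wp w (BinOp f r x y) Q s \<longleftrightarrow>
     Q 1 (s\<lparr>reg := (reg s)(r := word_op_val w f (reg s x) (reg s y))\<rparr>)"
  unfolding wp_def by (auto intro: exec_BinOp[simplified] elim!: exec_BinOpE)

lemma wp_Load [simp]:
  "wp w (Load r x) Q s \<longleftrightarrow> Q 1 (s\<lparr>reg := (reg s)(r := mem s (reg s x))\<rparr>)"
  unfolding wp_def by (auto intro: exec_Load[simplified] elim!: exec_LoadE)

lemma wp_Store [simp]:
  "wp w (Store x r) Q s \<longleftrightarrow> Q 1 (s\<lparr>mem := (mem s)(reg s x := reg s r)\<rparr>)"
  unfolding wp_def by (auto intro: exec_Store[simplified] elim!: exec_StoreE)

lemma wp_Seq [simp]:
  "wp w (Seq p q) Q s \<longleftrightarrow> wp w p (\<lambda>t. wp w q (\<lambda>u. Q (t + u))) s"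
  unfolding wp_def by (blast intro: exec_Seq elim: exec_SeqE)

lemma wp_Branch [simp]:
  "wp w (Branch f x y p q) Q s \<longleftrightarrow>
     (if cmp_val f (reg s x) (reg s y) then wp w p (\<lambda>t. Q (Suc t)) s
      else wp w q (\<lambda>t. Q (Suc t)) s)"
  unfolding wp_def by (auto intro: exec_BranchTrue exec_BranchFalse elim!: exec_BranchE)

text \<open>Every loop of the program is a counting loop, so an invariant indexed by the number of
  finished iterations replaces a termination measure. Each iteration pays one unit for the guard,
  and the failing test pays the last one.\<close>

lemma wp_While_counted:
  assumes init: "I 0 s"
    and guard: "\<And>i s. i \<le> m \<Longrightarrow> I i s \<Longrightarrow> cmp_val f (reg s x) (reg s y) \<longleftrightarrow> i < m"
    and body: "\<And>i s. i < m \<Longrightarrow> I i s \<Longrightarrow> wp w p (\<lambda>t s'. t \<le> c \<and> I (Suc i) s') s"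
    and final: "\<And>t s. t \<le> m * Suc c + 1 \<Longrightarrow> I m s \<Longrightarrow> Q t s"
  shows "wp w (While f x y p) Q s"
proof -
  \<comment> \<open>Generalised to an arbitrary iteration \<open>i\<close>, for an induction on the
    number of iterations still to come.\<close>
  have "wp w (While f x y p) (\<lambda>t s'. t \<le> (m - i) * Suc c + 1 \<and> I m s') s"
    if "i \<le> m" "I i s" for i s
    using that
  proof (induction "m - i" arbitrary: i s)
    case 0
    then have "exec w (While f x y p) s 1 s"
      using guard[of i s] by (auto intro!: exec_WhileFalse simp del: One_nat_def)
    with 0 show ?case unfolding wp_def by (auto intro!: exI)
  next
    case (Suc l)
    then have "i < m" by simp
    then obtain t s' where t: "exec w p s t s'" "t \<le> c" "I (Suc i) s'"
      using body Suc.prems unfolding wp_def by blast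
    have "wp w (While f x y p) (\<lambda>t s'. t \<le> (m - Suc i) * Suc c + 1 \<and> I m s') s'"
      by (rule Suc.hyps) (use Suc.hyps \<open>i < m\<close> t in auto)
    then obtain u s'' where u: "exec w (While f x y p) s' u s''"
      "u \<le> (m - Suc i) * Suc c + 1" "I m s''"
      unfolding wp_def by blast
    have "exec w (While f x y p) s (Suc (t + u)) s''"
      using guard[of i s] Suc.prems \<open>i < m\<close> t u by (auto intro!: exec_WhileTrue)
    moreover have "m - i = Suc (m - Suc i)" using \<open>i < m\<close> by simp
    then have "Suc (t + u) \<le> (m - i) * Suc c + 1" using t(2) u(2) by simp
    ultimately show ?case using u(3) unfolding wp_def by blast
  qed
  from this[of 0 s] init final show ?thesis by (auto elim!: wp_mono)
qed

primrec seqs :: "prog list \<Rightarrow> prog" where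
  "seqs [] = Skip"
| "seqs (p # ps) = Seq p (seqs ps)"

subsection \<open>Inclusion-exclusion and the zeta transform\<close>

text \<open>Multiplying out a product of binomials: the bits of \<open>S\<close> mark the factors
  that contribute \<open>u\<close>. The induction splits the numbers below \<open>2 ^ Suc d\<close>
  by their top bit.\<close>

lemma sum_prod_bits:
  fixes u v :: "nat \<Rightarrow> 'a :: comm_ring_1"
  shows "(\<Sum>S<2 ^ d. \<Prod>x<d. if bit (S::nat) x then u x else v x) = (\<Prod>x<d. u x + v x)"
proof (induction d)
  case (Suc d)
  let ?g = "\<lambda>S. \<Prod>x<Suc d. if bit (S::nat) x then u x else v x"
  let ?h = "\<lambda>S. \<Prod>x<d. if bit (S::nat) x then u x else v x"
  have "(\<Sum>S<2 ^ Suc d. ?g S) = (\<Sum>S<2 ^ d. ?g S) + (\<Sum>S<2 ^ d. ?g (2 ^ d + S))"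
    by (simp add: mult_2 lessThan_atLeast0 add.commute
        sum.atLeastLessThan_concat[of 0 "2 ^ d" "2 ^ d + 2 ^ d", symmetric]
        sum.shift_bounds_nat_ivl[of _ 0 "2 ^ d" "2 ^ d", simplified])
  moreover have "?g S = ?h S * v d" if "S < 2 ^ d" for S
    using that by (simp add: bit_iff_odd)
  moreover have "?g (2 ^ d + S) = ?h S * u d" if "S < 2 ^ d" for S
  proof -
    have "bit (2 ^ d + S) x \<longleftrightarrow> bit S x" if "x < d" for x
    proof -
      \<comment> \<open>Divided by \<open>2 ^ x\<close>, the summand \<open>2 ^ d\<close> is still
        even, so adding it does not change bit \<open>x\<close>.\<close>
      have "(2::nat) ^ d = 2 ^ x * (2 * 2 ^ (d - Suc x))"
        using that by (simp add: power_add[symmetric] power_Suc[symmetric] del: power_Suc)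
      then show ?thesis by (simp add: bit_iff_odd)
    qed
    then have "?h (2 ^ d + S) = ?h S" by (intro prod.cong) auto
    moreover have "bit (2 ^ d + S) d" using that by (simp add: bit_iff_odd)
    ultimately show ?thesis by simp
  qed
  ultimately show ?case
    using Suc by (simp add: sum_distrib_right[symmetric] distrib_left add.commute)
qed simp

text \<open>The product of the counts is a sum over all tuples \<open>f\<close>. After exchanging
  the sums, the contribution of \<open>S\<close> to a fixed \<open>f\<close> factors over the
  coordinates, so \<open>sum_prod_bits\<close> evaluates it to the indicator of
  orthogonality.\<close>

lemma inclusion_exclusion_tuples:
  fixes b :: "nat \<Rightarrow> nat \<Rightarrow> nat \<Rightarrow> bool"
  shows "(\<Sum>S<2 ^ d. (\<Prod>x<d. if bit (S::nat) x then - 1 else 1) *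
            (\<Prod>i<k. int (card {j. j < n \<and> (\<forall>x<d. bit S x \<longrightarrow> b i j x)})))
         = int (card {f \<in> {..<k} \<rightarrow>\<^sub>E {..<n}. \<forall>x<d. \<exists>i<k. \<not> b i (f i) x})"
proof -
  let ?F = "{..<k} \<rightarrow>\<^sub>E {..<n}"
  have fin: "finite ?F" by (intro finite_PiE) auto
  have ind: "(\<Prod>i\<in>I. of_bool (P i)) = (of_bool (\<forall>i\<in>I. P i) :: int)" if "finite I"
    for I :: "nat set" and P
    using that by (induction I) auto
  have "(\<Prod>x<d. if bit S x then - 1 else 1) *
            (\<Prod>i<k. int (card {j. j < n \<and> (\<forall>x<d. bit S x \<longrightarrow> b i j x)}))
     = (\<Sum>f\<in>?F. \<Prod>x<d. if bit S x then - of_bool (\<forall>i<k. b i (f i) x) else 1)" for S :: nat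
  proof -
    have "int (card {j. j < n \<and> (\<forall>x<d. bit S x \<longrightarrow> b i j x)})
       = (\<Sum>j<n. of_bool (\<forall>x<d. bit S x \<longrightarrow> b i j x))" for i
      by (simp add: of_bool_def sum.If_cases) (simp add: Int_def)
    then have "(\<Prod>i<k. int (card {j. j < n \<and> (\<forall>x<d. bit S x \<longrightarrow> b i j x)}))
       = (\<Sum>f\<in>?F. \<Prod>i<k. of_bool (\<forall>x<d. bit S x \<longrightarrow> b i (f i) x))"
      by (simp only: prod_sum_PiE finite_lessThan simp_thms)
    moreover have "(\<Prod>x<d. if bit S x then - 1 else 1) *
        (\<Prod>i<k. of_bool (\<forall>x<d. bit S x \<longrightarrow> b i (f i) x))
      = (\<Prod>x<d. if bit S x then - of_bool (\<forall>i<k. b i (f i) x) else (1::int))" for f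
    proof -
      have "(\<Prod>i<k. of_bool (\<forall>x<d. bit S x \<longrightarrow> b i (f i) x))
        = (\<Prod>x<d. of_bool (bit S x \<longrightarrow> (\<forall>i<k. b i (f i) x)) :: int)"
        by (simp only: ind finite_lessThan) (auto simp: of_bool_def)
      then show ?thesis by (simp only: prod.distrib[symmetric]) (auto intro!: prod.cong)
    qed
    ultimately show ?thesis by (simp add: sum_distrib_left)
  qed
  then have "(\<Sum>S<2 ^ d. (\<Prod>x<d. if bit (S::nat) x then - 1 else 1) *
            (\<Prod>i<k. int (card {j. j < n \<and> (\<forall>x<d. bit S x \<longrightarrow> b i j x)})))
     = (\<Sum>f\<in>?F. \<Sum>S<2 ^ d. \<Prod>x<d.
           if bit (S::nat) x then - of_bool (\<forall>i<k. b i (f i) x) else 1)"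
    by (simp add: sum.swap[of _ _ "{..<2 ^ d}"])
  \<comment> \<open>With \<open>v = 1\<close> and \<open>u\<close> minus the indicator that all
    vectors of the tuple contain \<open>x\<close>, each factor \<open>u + v\<close> indicates that
    some vector misses \<open>x\<close>.\<close>
  also have "\<dots> = (\<Sum>f\<in>?F. \<Prod>x<d. of_bool (\<exists>i<k. \<not> b i (f i) x))"
    unfolding sum_prod_bits by (intro sum.cong prod.cong) auto
  also have "\<dots> = (\<Sum>f\<in>?F. of_bool (\<forall>x<d. \<exists>i<k. \<not> b i (f i) x))"
    by (simp add: ind Ball_def)
  also have "\<dots> = int (card {f \<in> ?F. \<forall>x<d. \<exists>i<k. \<not> b i (f i) x})"
    using fin by (simp add: of_bool_def sum.If_cases) (simp add: Int_def)
  finally show ?thesis .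
qed

section \<open>The zeta transform as counting under relaxed bit conditions\<close>

lemma set_bit_eq_add: "\<not> bit (T::nat) x \<Longrightarrow> set_bit x T = T + 2 ^ x"
  by (simp add: set_bit_eq)

text \<open>For \<open>v < V\<close>, think of \<open>m v\<close> as a bit vector: this is the content of cell \<open>T\<close> after \<open>x\<close> rounds of
  the zeta transform applied to the histogram of \<open>m\<close>.\<close>

definition dominating :: "(nat \<Rightarrow> nat) \<Rightarrow> nat \<Rightarrow> nat \<Rightarrow> nat \<Rightarrow> nat" where
  "dominating m V x T =
     card {v. v < V \<and> (\<forall>y. if y < x then bit T y \<longrightarrow> bit (m v) y else bit T y \<longleftrightarrow> bit (m v) y)}"

lemma dominating_0: "dominating m V 0 T = card {v. v < V \<and> m v = T}"
proof -
  have "(\<forall>y. bit T y \<longleftrightarrow> bit (m v) y) \<longleftrightarrow> m v = T" for v by (auto simp: bit_eq_iff)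
  then show ?thesis by (simp add: dominating_def)
qed

lemma dominating_0_Suc:
  "dominating m (Suc V) 0 T = dominating m V 0 T + of_bool (m V = T)"
proof -
  have "{v. v < Suc V \<and> m v = T} = {v. v < V \<and> m v = T} \<union> (if m V = T then {V} else {})"
    by (auto simp: less_Suc_eq)
  then show ?thesis by (simp add: dominating_0 split: split_of_bool)
qed

lemma dominating_le: "dominating m V x T \<le> V"
  unfolding dominating_def by (rule order_trans[OF card_mono[of "{..<V}"]]) auto

text \<open>Round \<open>x\<close> relaxes only the condition at coordinate \<open>x\<close>. If
  \<open>T\<close> lacks that bit, the vectors newly allowed are those containing \<open>x\<close>,
  and they are counted at \<open>T + 2 ^ x\<close>.\<close>

lemma dominating_Suc:
  "dominating m V (Suc x) T =
     dominating m V x T + (if bit T x then 0 else dominating m V x (T + 2 ^ x))"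
proof -
  define P where "P x T v \<longleftrightarrow>
    (\<forall>y. if y < x then bit T y \<longrightarrow> bit (m v) y else bit T y \<longleftrightarrow> bit (m v) y)" for x v and T :: nat
  \<comment> \<open>The condition away from coordinate \<open>x\<close>, common to both rounds and
    to both cells.\<close>
  define R where "R T v \<longleftrightarrow> (\<forall>y. y \<noteq> x \<longrightarrow>
    (if y < x then bit T y \<longrightarrow> bit (m v) y else bit T y \<longleftrightarrow> bit (m v) y))" for v and T :: nat
  have D: "dominating m V x T = card {v. v < V \<and> P x T v}" for x T
    by (simp add: dominating_def P_def)
  have split: "(\<forall>y. F y) \<longleftrightarrow> (\<forall>y. y \<noteq> x \<longrightarrow> F y) \<and> F x" for F by metis
  have P: "P x T v \<longleftrightarrow> R T v \<and> (bit T x \<longleftrightarrow> bit (m v) x)" for T v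
    unfolding P_def R_def by (subst split) simp
  have P_Suc: "P (Suc x) T v \<longleftrightarrow> R T v \<and> (bit T x \<longrightarrow> bit (m v) x)" for T v
    unfolding P_def R_def by (subst split) (simp add: less_Suc_eq)
  show ?thesis
  proof (cases "bit T x")
    case True
    then show ?thesis by (simp add: D P P_Suc)
  next
    case False
    have bit: "bit (T + 2 ^ x) y \<longleftrightarrow> bit T y \<or> y = x" for y
      using False by (auto simp: bit_set_bit_iff simp flip: set_bit_eq_add)
    then have "R (T + 2 ^ x) v \<longleftrightarrow> R T v" for v
      by (simp add: R_def)
    then have "{v. v < V \<and> P (Suc x) T v} =
        {v. v < V \<and> P x T v} \<union> {v. v < V \<and> P x (T + 2 ^ x) v}"
      "{v. v < V \<and> P x T v} \<inter> {v. v < V \<and> P x (T + 2 ^ x) v} = {}"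
      using False bit by (auto simp: P P_Suc)
    with False show ?thesis by (simp add: D card_Un_disjoint)
  qed
qed

text \<open>As \<open>k * 2 ^ d\<close> need not be a power of two, the argument is that setting a
  bit below \<open>d\<close> keeps the quotient by \<open>2 ^ d\<close>: a zeta step stays within
  the block of one family.\<close>

lemma add_two_power_less:
  assumes "T < k * 2 ^ d" "x < d" "\<not> bit (T::nat) x"
  shows "T + 2 ^ x < k * 2 ^ d"
proof -
  have "drop_bit d (set_bit x T) = drop_bit d T"
    by (rule bit_eqI) (use assms(2) in \<open>auto simp: bit_simps\<close>)
  then have "(T + 2 ^ x) div 2 ^ d = T div 2 ^ d"
    using assms(3) by (simp add: drop_bit_eq_div set_bit_eq_add)
  with assms(1) show ?thesis by (simp add: div_less_iff_less_mult[symmetric])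
qed

definition bits_val :: "(nat \<Rightarrow> bool) \<Rightarrow> nat \<Rightarrow> nat" where
  "bits_val b d = (\<Sum>y<d. of_bool (b y) * 2 ^ y)"

lemma bits_val_Suc: "bits_val b (Suc d) = bits_val b d + of_bool (b d) * 2 ^ d"
  and bits_val_0 [simp]: "bits_val b 0 = 0"
  by (simp_all add: bits_val_def)

lemma bits_val_less: "bits_val b d < 2 ^ d"
  by (induction d) (auto simp: bits_val_Suc)

text \<open>The two summands have no common bit, so the addition is a bitwise or.\<close>

lemma bit_add_mult_two_power:
  assumes "r < (2::nat) ^ d"
  shows "bit (i * 2 ^ d + r) y \<longleftrightarrow> (if y < d then bit r y else bit i (y - d))"
proof -
  have r: "\<not> bit r y" if "d \<le> y" for y
    using less_le_trans[OF assms power_increasing[OF that, of 2]] by (simp add: bit_iff_odd)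
  have "and (push_bit d i) r = 0"
    by (rule bit_eqI) (use r in \<open>auto simp: bit_simps\<close>)
  then have "i * 2 ^ d + r = or (push_bit d i) r"
    by (simp add: push_bit_eq_mult disjunctive_add_eq_or)
  with r show ?thesis by (auto simp: bit_simps)
qed

lemma bit_bits_val: "bit (bits_val b d) y \<longleftrightarrow> y < d \<and> b y"
proof (induction d)
  case (Suc d)
  have "bits_val b (Suc d) = of_bool (b d) * 2 ^ d + bits_val b d"
    by (simp add: bits_val_Suc)
  then show ?case
    using Suc by (simp only: bit_add_mult_two_power[OF bits_val_less])
      (auto simp: bit_simps less_Suc_eq)
qed simp

text \<open>The \<open>d\<close> rounds relax only positions below \<open>d\<close>. From position
  \<open>d\<close> on equality is still required, and there stands the family number, so one
  transform of the combined table acts as \<open>k\<close> separate ones.\<close>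

lemma dominating_card_supersets:
  assumes m: "\<And>v. m v = v div n * 2 ^ d + bits_val (b v) d" and "i < k" "S < 2 ^ d"
  shows "dominating m (k * n) d (i * 2 ^ d + S) =
    card {j. j < n \<and> (\<forall>x<d. bit S x \<longrightarrow> b (i * n + j) x)}"
proof -
  have "(\<forall>y. if y < d then bit (i * 2 ^ d + S) y \<longrightarrow> bit (m v) y
        else bit (i * 2 ^ d + S) y \<longleftrightarrow> bit (m v) y)
      \<longleftrightarrow> v div n = i \<and> (\<forall>x<d. bit S x \<longrightarrow> b v x)" (is "?L \<longleftrightarrow> ?R") for v
  proof
    assume L: ?L
    have "bit (v div n) y \<longleftrightarrow> bit i y" for y
      using L[rule_format, of "y + d"] assms(3)
      by (simp add: m bit_add_mult_two_power bits_val_less)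
    moreover have "b v x" if "x < d" "bit S x" for x
      using L[rule_format, of x] assms(3) that
      by (simp add: m bit_add_mult_two_power bits_val_less bit_bits_val)
    ultimately show ?R by (simp add: bit_eq_iff)
  next
    assume ?R
    then show ?L
      using assms(3) by (auto simp: m bit_add_mult_two_power bits_val_less bit_bits_val)
  qed
  then have "dominating m (k * n) d (i * 2 ^ d + S)
      = card {v. v < k * n \<and> v div n = i \<and> (\<forall>x<d. bit S x \<longrightarrow> b v x)}"
    by (simp add: dominating_def)
  also have "{v. v < k * n \<and> v div n = i \<and> (\<forall>x<d. bit S x \<longrightarrow> b v x)} =
      (\<lambda>j. i * n + j) ` {j. j < n \<and> (\<forall>x<d. bit S x \<longrightarrow> b (i * n + j) x)}" (is "?A = _ ` ?B")
  proof (intro equalityI subsetI)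
    fix v assume "v \<in> ?A"
    then have "v = i * n + v mod n" "v mod n < n" "\<forall>x<d. bit S x \<longrightarrow> b v x"
      by (cases "n = 0"; auto)+
    then have "v mod n \<in> ?B" by simp
    with \<open>v = i * n + v mod n\<close> show "v \<in> (\<lambda>j. i * n + j) ` ?B" by (rule image_eqI)
  next
    fix v assume "v \<in> (\<lambda>j. i * n + j) ` ?B"
    then obtain j where j: "v = i * n + j" "j < n" "\<forall>x<d. bit S x \<longrightarrow> b v x" by auto
    then have "Suc i * n \<le> k * n" using assms(2) by (intro mult_le_mono1) simp
    with j show "v \<in> ?A" by auto
  qed
  also have "card \<dots> = card ?B" by (rule card_image) (auto simp: inj_on_def)
  finally show ?thesis .
qed

text \<open>\<open>S div 2 ^ x\<close> has the parity of the \<open>x\<close>-th bit of \<open>S\<close>.\<close>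

lemma parity_sum_shifts:
  "(if even (\<Sum>x<d. S div 2 ^ x) then 1 else - 1) = (\<Prod>x<d. if bit (S::nat) x then - 1 else (1::int))"
  by (induction d) (auto simp: bit_iff_odd)

text \<open>The new digit \<open>f k\<close> goes on top with weight \<open>n ^ k\<close>. For
  \<open>i < k\<close> this weight is a multiple of \<open>n ^ Suc i\<close> and leaves digit
  \<open>i\<close> alone.\<close>

lemma digits_surj:
  assumes "\<forall>i<k. f i < (n::nat)"
  shows "\<exists>c<n ^ k. \<forall>i<k. c div n ^ i mod n = f i"
  using assms
proof (induction k)
  case (Suc k)
  then obtain c where c: "c < n ^ k" "\<forall>i<k. c div n ^ i mod n = f i" by auto
  have fk: "f k < n" using Suc.prems by simp
  have "f k * n ^ k + c < n ^ Suc k"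
  proof -
    have "Suc (f k) * n ^ k \<le> n * n ^ k" using fk by (intro mult_le_mono1) simp
    with c(1) show ?thesis by simp
  qed
  moreover have "(f k * n ^ k + c) div n ^ i mod n = f i" if "i < Suc k" for i
  proof (cases "i = k")
    case True
    with c(1) fk show ?thesis by (simp add: gr_implies_not0)
  next
    case False
    with that have "i < k" by simp
    then have "n ^ k = n ^ i * (n * n ^ (k - Suc i))"
      by (simp add: power_add[symmetric] power_Suc[symmetric] del: power_Suc)
    then have eq: "f k * n ^ k + c = c + n ^ i * (n * (n ^ (k - Suc i) * f k))"
      by (simp add: ac_simps)
    have "(f k * n ^ k + c) div n ^ i = c div n ^ i + n * (n ^ (k - Suc i) * f k)"
      unfolding eq using fk by simp
    with c(2) \<open>i < k\<close> show ?thesis by simp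
  qed
  ultimately show ?case by blast
qed simp

subsection \<open>Input encoding\<close>

lemma concat_nth_uniform:
  assumes "\<forall>xs\<in>set xss. length xs = m" "i < length xss" "j < m"
  shows "concat xss ! (i * m + j) = xss ! i ! j"
  using assms
proof (induction xss arbitrary: i)
  case (Cons xs xss)
  then show ?case by (cases i) (auto simp: nth_append)
qed simp

lemma length_concat_uniform:
  "\<forall>xs\<in>set xss. length xs = m \<Longrightarrow> length (concat xss) = length xss * m"
  by (induction xss) auto

text \<open>Numbering vector \<open>j\<close> of family \<open>i\<close> as
  \<open>v = i * n + j\<close> flattens the nested layout into a matrix with rows of length
  \<open>d\<close>. \<open>Suc x\<close> occurs because the universe starts at 1. The zeros behind
  the input later serve as an empty histogram.\<close>

lemma kov_encode_initial:
  assumes "kov_instance k n d As"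
  shows "\<lbrakk>v < k * n; x < d\<rbrakk> \<Longrightarrow> mem (initial_state (kov_encode n d As)) (2 + v * d + x) =
      of_bool (Suc x \<in> As ! (v div n) ! (v mod n))"
    and "2 + k * (n * d) \<le> a \<Longrightarrow> mem (initial_state (kov_encode n d As)) a = 0"
proof -
  define enc where "enc a = map (\<lambda>x. if x \<in> a then 1 else 0 :: nat) [1..<Suc d]" for a
  define rows where "rows = map (\<lambda>A. concat (map enc A)) As"
  have enc: "kov_encode n d As = n # d # concat rows"
    by (simp add: kov_encode_def enc_def[abs_def] rows_def del: upt_Suc)
  have len: "length As = k" "\<forall>A\<in>set As. length A = n"
    using assms by (auto simp: kov_instance_def)
  have row: "length (concat (map enc A)) = n * d" if "A \<in> set As" for A
    using that len by (subst length_concat_uniform[where m = d]) (auto simp: enc_def)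
  have total: "length (concat rows) = k * (n * d)"
    using len row by (subst length_concat_uniform[where m = "n * d"]) (auto simp: rows_def)
  show "mem (initial_state (kov_encode n d As)) a = 0" if "2 + k * (n * d) \<le> a"
    using that total by (simp add: initial_state_def enc)
  assume v: "v < k * n" and x: "x < d"
  have n: "n > 0" using v by (cases n) auto
  have i: "v div n < k" and j: "v mod n < n"
    using v n by (simp_all add: div_less_iff_less_mult)
  have "Suc (v mod n) * d \<le> n * d" using j by (intro mult_le_mono1) simp
  then have jx: "v mod n * d + x < n * d" using x by simp
  have "v * d + x = (v div n * n + v mod n) * d + x" by simp
  also have "\<dots> = v div n * (n * d) + (v mod n * d + x)"
    by (simp only: algebra_simps)
  finally have a: "v * d + x = v div n * (n * d) + (v mod n * d + x)" .
  have "Suc (v div n) * (n * d) \<le> k * (n * d)" using i by (intro mult_le_mono1) simp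
  then have "v * d + x < k * (n * d)" using a jx by simp
  then have "mem (initial_state (kov_encode n d As)) (2 + v * d + x) = concat rows ! (v * d + x)"
    using total by (simp add: initial_state_def enc)
  also have "\<dots> = rows ! (v div n) ! (v mod n * d + x)"
    unfolding a using i jx len row by (intro concat_nth_uniform) (auto simp: rows_def)
  also have "\<dots> = concat (map enc (As ! (v div n))) ! (v mod n * d + x)"
    using i len by (simp add: rows_def)
  also have "\<dots> = map enc (As ! (v div n)) ! (v mod n) ! x"
    using i j x len by (intro concat_nth_uniform) (auto simp: enc_def)
  also have "\<dots> = of_bool (Suc x \<in> As ! (v div n) ! (v mod n))"
    using i j x len by (simp add: enc_def One_nat_def del: upt_Suc)
  finally show "mem (initial_state (kov_encode n d As)) (2 + v * d + x) =
      of_bool (Suc x \<in> As ! (v div n) ! (v mod n))" .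
qed

lemma kov_yes_index:
  assumes "kov_instance k n d As" "k \<ge> 1"
  shows "kov_yes As \<longleftrightarrow> (\<exists>f. (\<forall>i<k. f i < n) \<and> (\<forall>x<d. \<exists>i<k. Suc x \<notin> As ! i ! f i))"
proof -
  have len: "length As = k" "\<And>i. i < k \<Longrightarrow> length (As ! i) = n"
    and sub: "\<And>i a. i < k \<Longrightarrow> a \<in> set (As ! i) \<Longrightarrow> a \<subseteq> {1..d}"
    using assms unfolding kov_instance_def by (auto, (metis atLeastAtMost_iff nth_mem subsetD)+)
  show ?thesis
  proof
    assume "kov_yes As"
    then obtain a where a: "\<And>i. i < k \<Longrightarrow> a i \<in> set (As ! i)" "(\<Inter>i<k. a i) = {}"
      by (auto simp: kov_yes_def len)
    have "\<forall>i. \<exists>j. i < k \<longrightarrow> j < n \<and> As ! i ! j = a i"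
      using a(1) len(2) by (metis in_set_conv_nth)
    then obtain f where f: "\<And>i. i < k \<Longrightarrow> f i < n \<and> As ! i ! f i = a i" by metis
    have "\<exists>i<k. Suc x \<notin> As ! i ! f i" for x
    proof -
      have "Suc x \<notin> (\<Inter>i<k. a i)" using a(2) by simp
      then show ?thesis using f by auto
    qed
    with f show "\<exists>f. (\<forall>i<k. f i < n) \<and> (\<forall>x<d. \<exists>i<k. Suc x \<notin> As ! i ! f i)" by blast
  next
    assume "\<exists>f. (\<forall>i<k. f i < n) \<and> (\<forall>x<d. \<exists>i<k. Suc x \<notin> As ! i ! f i)"
    then obtain f where f: "\<And>i. i < k \<Longrightarrow> f i < n" "\<And>x. x < d \<Longrightarrow> \<exists>i<k. Suc x \<notin> As ! i ! f i"
      by blast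
    have mem: "As ! i ! f i \<in> set (As ! i)" if "i < k" for i using f(1) len(2) that by simp
    have "y \<notin> (\<Inter>i<k. As ! i ! f i)" for y
    proof
      assume y: "y \<in> (\<Inter>i<k. As ! i ! f i)"
      \<comment> \<open>An intersection of at least one set is confined to \<open>{1..d}\<close>, so
        checking the coordinates below \<open>d\<close> shows that it is empty.\<close>
      have "0 < k" using assms(2) by simp
      then have "y \<in> As ! 0 ! f 0" using y by auto
      then have "y \<in> {1..d}" using sub[OF \<open>0 < k\<close> mem[OF \<open>0 < k\<close>]] by (rule subsetD[rotated])
      then obtain x where "y = Suc x" "x < d" by (cases y) auto
      with f(2) y show False by auto
    qed
    then have "(\<Inter>i<k. As ! i ! f i) = {}" by blast
    with mem show "kov_yes As" unfolding kov_yes_def len by (intro exI[of _ "\<lambda>i. As ! i ! f i"]) simp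
  qed
qed

subsection \<open>Size estimates\<close>

text \<open>This absorbs the linear factor. It is \<open>1 + t \<le> exp t\<close> at
  \<open>t = d / (2 * k) * ln 2\<close>; the constant \<open>4 * k\<close> clears the denominator
  \<open>2 * k\<close> and the bound \<open>1 / 2\<close> for \<open>ln 2\<close>.\<close>

lemma Suc_le_two_powr:
  assumes "k \<ge> 1"
  shows "real d + 1 \<le> 4 * real k * 2 powr (real d / (2 * real k))"
proof -
  \<comment> \<open>From \<open>ln x \<le> x - 1\<close> at \<open>x = 1 / 2\<close>.\<close>
  have "1 / 2 \<le> ln (2 :: real)" using ln_le_minus_one[of "1 / 2 :: real"] by (simp add: ln_div)
  then have "1 + real d / (2 * real k) * (1 / 2) \<le> 1 + real d / (2 * real k) * ln 2"
    by (intro add_left_mono mult_left_mono) auto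
  also have "\<dots> \<le> exp (real d / (2 * real k) * ln 2)" by (rule exp_ge_add_one_self)
  also have "\<dots> = 2 powr (real d / (2 * real k))" by (simp add: powr_def)
  finally have "4 * real k * (1 + real d / (2 * real k) * (1 / 2)) \<le>
      4 * real k * 2 powr (real d / (2 * real k))"
    by (intro mult_left_mono) auto
  moreover have "4 * real k * (1 + real d / (2 * real k) * (1 / 2)) = 4 * real k + real d"
    using assms by (simp add: field_simps)
  ultimately show ?thesis using assms by linarith
qed

text \<open>In terms of \<open>y = 2 powr (d / (2k))\<close> the crossover is
  \<open>n = y ^ 2\<close>, the target is \<open>z = y ^ (2k - 1)\<close>, and
  \<open>2 ^ d = z * y\<close>. So \<open>y * 2 ^ d = y ^ 2 * z \<le> n * z\<close> on one side and
  \<open>y * n ^ k \<le> y * (y ^ 2) ^ (k - 1) * n = z * n\<close> on the other. The constant is 100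
  times \<open>4 * k\<close> for \<open>d + 1\<close>, times 2 for the sum \<open>n + 2 ^ d\<close>,
  times \<open>k\<close>.\<close>

lemma running_time_bound:
  fixes k n d :: nat
  assumes k: "k \<ge> 1" and n: "n \<ge> 1"
  shows "real (100 * k * (d + 1) * (if 2 ^ d \<le> n ^ k then n + 2 ^ d else n ^ k)) \<le>
    800 * real k ^ 2 * (2 powr ((1 - 1 / (2 * real k)) * real d) * real n)"
proof -
  define y where "y = 2 powr (real d / (2 * real k))"
  define z where "z = 2 powr ((1 - 1 / (2 * real k)) * real d)"
  have y: "y > 0" "y \<ge> 1" unfolding y_def by (auto intro: ge_one_powr_ge_zero)
  have z: "z > 0" unfolding z_def by simp
  have d1: "real d + 1 \<le> 4 * real k * y" unfolding y_def by (rule Suc_le_two_powr[OF k])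
  have yk: "y ^ 2 = 2 powr (real d / real k)"
    using k by (simp add: y_def powr_realpow[symmetric] powr_powr field_simps)
  have yyk: "(y ^ 2) ^ k = 2 ^ d"
    unfolding yk using k by (simp add: powr_realpow[symmetric] powr_powr)
  have zy: "z * y = 2 ^ d"
    using k by (simp add: y_def z_def powr_realpow[symmetric] powr_add[symmetric] field_simps)
  have zyy: "z = y * (y ^ 2) ^ (k - 1)"
  proof -
    have "z * y = (y * (y ^ 2) ^ (k - 1)) * y"
      using k by (cases k) (simp_all add: zy yyk[symmetric] power2_eq_square)
    then show ?thesis using y by simp
  qed
  have key: "(real d + 1) * real (if 2 ^ d \<le> n ^ k then n + 2 ^ d else n ^ k) \<le> 8 * real k * (z * real n)"
  proof (cases "(2::nat) ^ d \<le> n ^ k")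
    case True
    then have "(2::real) ^ d \<le> real n ^ k" by (metis of_nat_le_iff of_nat_power of_nat_numeral)
    then have "y ^ 2 \<le> real n"
      unfolding yyk[symmetric] using k by (metis of_nat_0_le_iff power_le_imp_le_base Suc_diff_1 less_le_trans zero_less_one)
    then have "y * 2 ^ d \<le> z * real n"
      unfolding zy[symmetric] using z by (simp add: power2_eq_square mult.assoc mult.left_commute)
    \<comment> \<open>Since \<open>y \<ge> 1\<close>, also \<open>y \<le> z\<close>; this takes care
      of the summand \<open>n\<close>.\<close>
    moreover have "y * 1 \<le> y * (y ^ 2) ^ (k - 1)"
      using y by (intro mult_left_mono one_le_power) auto
    then have "y * real n \<le> z * real n" unfolding zyy by (intro mult_right_mono) auto
    ultimately have "y * (real n + 2 ^ d) \<le> 2 * (z * real n)" by (simp add: distrib_left)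
    then have "4 * real k * (y * (real n + 2 ^ d)) \<le> 4 * real k * (2 * (z * real n))"
      by (intro mult_left_mono) auto
    moreover have "(real d + 1) * (real n + 2 ^ d) \<le> 4 * real k * y * (real n + 2 ^ d)"
      by (intro mult_right_mono d1) auto
    ultimately have "(real d + 1) * (real n + 2 ^ d) \<le> 8 * real k * (z * real n)"
      by (simp only: mult.assoc)
    with True show ?thesis by simp
  next
    case False
    then have "real n ^ k \<le> 2 ^ d" by (metis nat_le_linear of_nat_le_iff of_nat_power of_nat_numeral)
    then have "real n \<le> y ^ 2"
      unfolding yyk[symmetric] using k by (metis zero_le_power2 power_le_imp_le_base Suc_diff_1 less_le_trans zero_less_one)
    then have "real n ^ (k - 1) \<le> (y ^ 2) ^ (k - 1)" by (intro power_mono) auto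
    then have "y * real n ^ (k - 1) \<le> z" unfolding zyy using y by (intro mult_left_mono) auto
    then have "y * real n ^ (k - 1) * real n \<le> z * real n" by (rule mult_right_mono) simp
    then have "y * real n ^ k \<le> z * real n"
      using k by (cases k) (simp_all add: ac_simps)
    then have "4 * real k * (y * real n ^ k) \<le> 4 * real k * (z * real n)"
      by (intro mult_left_mono) auto
    moreover have "(real d + 1) * real n ^ k \<le> 4 * real k * y * real n ^ k"
      by (intro mult_right_mono d1) auto
    moreover have "0 \<le> real k * (z * real n)" using z by simp
    ultimately show ?thesis using False by (simp add: mult.assoc)
  qed
  have "real (100 * k * (d + 1) * (if 2 ^ d \<le> n ^ k then n + 2 ^ d else n ^ k)) =
      100 * real k * ((real d + 1) * real (if 2 ^ d \<le> n ^ k then n + 2 ^ d else n ^ k))"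
    by (simp only: of_nat_mult of_nat_add of_nat_numeral of_nat_1 mult.assoc)
  also have "\<dots> \<le> 100 * real k * (8 * real k * (z * real n))"
    by (intro mult_left_mono key) auto
  finally show ?thesis by (simp add: z_def power2_eq_square mult.assoc)
qed

text \<open>Up to a factor 10 the left side is at most \<open>k * n ^ k * 2 ^ d\<close>. With
  \<open>10 < 2 ^ 4\<close>, \<open>k \<le> 2 ^ k\<close> and \<open>L = log 2 (n + 1)\<close>, the
  exponent \<open>4 + k + k * L + d\<close> must be covered; \<open>d \<le> (c + 1) * L\<close> and
  \<open>1 \<le> L\<close> bound it by \<open>(2 * k + c + 5) * L\<close>.\<close>

lemma word_fits:
  fixes k n d w :: nat and c :: real
  assumes k: "k \<ge> 1" and n: "n \<ge> 1" and c: "c > 0"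
    and d: "\<bar>real d - c * log 2 (real n)\<bar> < 1"
    and w: "real w \<ge> (2 * real k + c + 5) * log 2 (real n + 1)"
  shows "2 + k * (n * d) + d + k * n + k * 2 ^ d + 2 * 2 ^ d + n ^ k * 2 ^ d + n ^ k < 2 ^ w"
proof -
  define M where "M = k * (n ^ k * 2 ^ d)"
  have nk: "n \<le> n ^ k" using n k by (simp add: self_le_power)
  have dd: "d \<le> 2 ^ d" by (simp add: less_imp_le)
  have k1: "1 * x \<le> k * x" for x using k by (intro mult_le_mono1)
  have nk1: "1 * 2 ^ d \<le> n ^ k * 2 ^ d" using n by (intro mult_le_mono1) simp
  have d1: "n ^ k * 1 \<le> n ^ k * 2 ^ d" by (intro mult_le_mono2) simp
  have "1 \<le> M" using k n by (simp add: M_def Suc_le_eq One_nat_def)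
  moreover have "k * (n * d) \<le> M"
    unfolding M_def by (intro mult_le_mono nk dd le_refl)
  moreover have "n ^ k * 2 ^ d \<le> M" using k1[of "n ^ k * 2 ^ d"] by (simp add: M_def)
  moreover have "k * n \<le> M"
    unfolding M_def using nk d1 by (intro mult_le_mono2) linarith
  moreover have "k * 2 ^ d \<le> M"
    unfolding M_def using nk1 by (intro mult_le_mono2) linarith
  ultimately have "2 + k * (n * d) + d + k * n + k * 2 ^ d + 2 * 2 ^ d + n ^ k * 2 ^ d + n ^ k \<le> 10 * M"
    using dd nk1 d1 by linarith
  also have "10 * M < 16 * (2 ^ k * (n ^ k * 2 ^ d))"
  proof -
    have "M \<le> 2 ^ k * (n ^ k * 2 ^ d)" unfolding M_def by (intro mult_le_mono1) (simp add: less_imp_le)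
    with \<open>1 \<le> M\<close> show ?thesis by linarith
  qed
  also have "16 * (2 ^ k * (n ^ k * 2 ^ d)) \<le> (2::nat) ^ w"
  proof -
    define L where "L = log 2 (real n + 1)"
    \<comment> \<open>The argument \<open>n + 1\<close> instead of \<open>n\<close> gives this even
      for \<open>n = 1\<close>, so additive constants become multiples of \<open>L\<close>.\<close>
    have L: "L \<ge> 1" unfolding L_def using n by (simp add: le_log_iff)
    have nL: "real n \<le> 2 powr L" unfolding L_def using n by simp
    have "log 2 (real n) \<le> L" unfolding L_def using n by simp
    then have "c * log 2 (real n) \<le> c * L" using c by (intro mult_left_mono) auto
    then have "real d \<le> c * L + L" using d L by linarith
    moreover have "4 + real k \<le> (4 + real k) * L"
      using mult_left_mono[OF L, of "4 + real k"] by simp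
    ultimately have "4 + real k + real k * L + real d \<le> (2 * real k + c + 5) * L"
      by (simp add: algebra_simps)
    also have "\<dots> \<le> real w" using w unfolding L_def .
    finally have le: "4 + real k + real k * L + real d \<le> real w" .
    have "real (16 * (2 ^ k * (n ^ k * 2 ^ d))) = 2 powr 4 * (2 powr real k * (real n ^ k * 2 powr real d))"
      by (simp add: powr_realpow)
    also have "\<dots> \<le> 2 powr 4 * (2 powr real k * ((2 powr L) ^ k * 2 powr real d))"
      using nL by (intro mult_left_mono mult_right_mono power_mono) auto
    also have "(2 powr L) ^ k = 2 powr (real k * L)"
      by (simp add: powr_realpow[symmetric] powr_powr mult.commute)
    also have "2 powr 4 * (2 powr real k * (2 powr (real k * L) * 2 powr real d)) =
        2 powr (4 + real k + real k * L + real d)"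
      by (simp only: powr_add mult.assoc)
    also have "\<dots> \<le> 2 powr real w" using le by simp
    also have "\<dots> = real (2 ^ w)" by (simp add: powr_realpow)
    finally show ?thesis by (simp only: of_nat_le_iff)
  qed
  finally show ?thesis .
qed

subsection \<open>The program\<close>

text \<open>Truncation is replaced by a side condition that the result fits a word, so
  \<open>mod 2 ^ w\<close> never enters the invariants.\<close>

lemma word_op_val_exact:
  "x + y < 2 ^ w \<Longrightarrow> word_op_val w Add x y = x + y"
  "x * y < 2 ^ w \<Longrightarrow> word_op_val w Mul x y = x * y"
  "x < 2 ^ w \<Longrightarrow> word_op_val w Div x y = x div y"
  "x < 2 ^ w \<Longrightarrow> word_op_val w Mod x y = x mod y"
  "x * 2 ^ y < 2 ^ w \<Longrightarrow> word_op_val w Shl x y = x * 2 ^ y"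
  by (simp_all add: push_bit_eq_mult le_less_trans[OF div_le_dividend]
      le_less_trans[OF mod_less_eq_dividend])

lemma wp_Const_exact:
  "v < 2 ^ w \<Longrightarrow> wp w (Const r v) Q s \<longleftrightarrow> Q 1 (s\<lparr>reg := (reg s)(r := v)\<rparr>)"
  by simp

declare word_op_val.simps [simp del] wp_Const [simp del] One_nat_def [simp del] split_of_bool [split del]

text \<open>Registers that are never written before being read rely on their initial value 0.\<close>

abbreviation (input) "rAns \<equiv> 0 :: nat"
abbreviation (input) "rN \<equiv> 2 :: nat"
abbreviation (input) "rD \<equiv> 3 :: nat"
abbreviation (input) "rK \<equiv> 4 :: nat"
abbreviation (input) "rOne \<equiv> 5 :: nat"
abbreviation (input) "rTwo \<equiv> 6 :: nat"
abbreviation (input) "rZero \<equiv> 7 :: nat"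
abbreviation (input) "rPow \<equiv> 8 :: nat"
abbreviation (input) "rTab \<equiv> 9 :: nat"
abbreviation (input) "rBlk \<equiv> 10 :: nat"
abbreviation (input) "rBase \<equiv> 11 :: nat"
abbreviation (input) "rSize \<equiv> 12 :: nat"
abbreviation (input) "rVecs \<equiv> 13 :: nat"
abbreviation (input) "rOuter \<equiv> 14 :: nat"
abbreviation (input) "rX \<equiv> 15 :: nat"
abbreviation (input) "rI \<equiv> 16 :: nat"
abbreviation (input) "rFlag \<equiv> 17 :: nat"
abbreviation (input) "rProd \<equiv> 18 :: nat"
abbreviation (input) "rRest \<equiv> 19 :: nat"
abbreviation (input) "rPtr \<equiv> 20 :: nat"
abbreviation (input) "rTmp \<equiv> 21 :: nat"
abbreviation (input) "rBit \<equiv> 22 :: nat"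
abbreviation (input) "rTmp' \<equiv> 23 :: nat"
abbreviation (input) "rEven \<equiv> 24 :: nat"
abbreviation (input) "rOdd \<equiv> 25 :: nat"

definition prepare :: "nat \<Rightarrow> prog" where
  "prepare k = seqs
    [Const rOne 1, Const rTwo 2, Const rK k, Load rN rZero, Load rD rOne,
     Const rPow 1, BinOp Shl rTab rOne rD, BinOp Mul rBlk rN rD,
     While Lt rI rK (seqs [BinOp Mul rPow rPow rN, BinOp Add rI rI rOne])]"

text \<open>The base-\<open>n\<close> digits of \<open>rOuter\<close> enumerate the tuples; vector \<open>j\<close> of family \<open>i\<close> has number
  \<open>i * n + j\<close>.\<close>

definition brute_and :: prog where
  "brute_and = While Lt rI rK (seqs
    [BinOp Mod rTmp rRest rN, BinOp Div rRest rRest rN, BinOp Mul rTmp rTmp rD,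
     BinOp Add rTmp rTmp rPtr, Load rTmp rTmp, BinOp Mul rProd rProd rTmp,
     BinOp Add rPtr rPtr rBlk, BinOp Add rI rI rOne])"

text \<open>Adding \<open>rZero\<close> is a register move. A product of bits equal to 1 means that
  all vectors of the tuple share coordinate \<open>x\<close>.\<close>

definition brute_tuple :: prog where
  "brute_tuple = While Lt rX rD (seqs
    [Const rProd 1, BinOp Add rRest rOuter rZero, Const rI 0, BinOp Add rPtr rTwo rX,
     brute_and, Branch Eq rProd rOne (Const rFlag 0) Skip, BinOp Add rX rX rOne])"

definition brute_force :: prog where
  "brute_force = While Lt rOuter rPow (seqs
    [Const rFlag 1, Const rX 0, brute_tuple,
     Branch Eq rFlag rOne (Const rAns 1) Skip, BinOp Add rOuter rOuter rOne])"

text \<open>All \<open>k\<close> tables of size \<open>2 ^ d\<close> are transformed simultaneously, as one table in which the family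
  number occupies the bits from position \<open>d\<close> on.\<close>

definition read_vector :: prog where
  "read_vector = While Lt rX rD (seqs
    [Load rTmp rPtr, BinOp Mul rTmp rTmp rBit, BinOp Add rProd rProd rTmp,
     BinOp Mul rBit rBit rTwo, BinOp Add rPtr rPtr rOne, BinOp Add rX rX rOne])"

text \<open>\<open>rPtr\<close> is never reset: reading one vector leaves it at the start of the
  next.\<close>

definition histogram :: prog where
  "histogram = While Lt rOuter rVecs (seqs
    [BinOp Div rProd rOuter rN, BinOp Mul rProd rProd rTab, Const rBit 1, Const rX 0,
     read_vector, BinOp Add rProd rProd rBase, Load rTmp rProd, BinOp Add rTmp rTmp rOne,
     Store rProd rTmp, BinOp Add rOuter rOuter rOne])"

definition zeta_step :: prog where
  "zeta_step = While Lt rOuter rSize (seqs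
    [BinOp Div rTmp rOuter rBit, BinOp Mod rTmp rTmp rTwo,
     Branch Eq rTmp rZero (seqs
       [BinOp Add rPtr rOuter rBase, BinOp Add rTmp' rPtr rBit, Load rTmp' rTmp',
        Load rTmp rPtr, BinOp Add rTmp rTmp rTmp', Store rPtr rTmp]) Skip,
     BinOp Add rOuter rOuter rOne])"

definition zeta :: prog where
  "zeta = While Lt rX rD (seqs
    [Const rOuter 0, zeta_step, BinOp Mul rBit rBit rTwo, BinOp Add rX rX rOne])"

definition table_product :: prog where
  "table_product = While Lt rI rK (seqs
    [Load rTmp rPtr, BinOp Mul rProd rProd rTmp, BinOp Add rPtr rPtr rTab,
     BinOp Add rI rI rOne])"

definition parity :: prog where
  "parity = While Lt rX rD (seqs
    [BinOp Add rFlag rFlag rRest, BinOp Mod rFlag rFlag rTwo, BinOp Div rRest rRest rTwo,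
     BinOp Add rX rX rOne])"

text \<open>Collecting the terms of either sign separately avoids negative numbers and wrap-around.\<close>

definition signed_sums :: prog where
  "signed_sums = While Lt rOuter rTab (seqs
    [Const rProd 1, Const rI 0, BinOp Add rPtr rBase rOuter, table_product,
     BinOp Add rRest rOuter rZero, Const rFlag 0, Const rX 0, parity,
     Branch Eq rFlag rZero (BinOp Add rEven rEven rProd) (BinOp Add rOdd rOdd rProd),
     BinOp Add rOuter rOuter rOne])"

definition inclusion_exclusion :: prog where
  "inclusion_exclusion = seqs
    [BinOp Mul rBase rK rBlk, BinOp Add rBase rBase rTwo, BinOp Mul rSize rK rTab,
     BinOp Mul rVecs rK rN, BinOp Add rPtr rTwo rZero, histogram,
     Const rBit 1, Const rX 0, zeta, Const rOuter 0, signed_sums,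
     Branch Ne rEven rOdd (Const rAns 1) Skip]"

text \<open>\<open>2 ^ d\<close> and \<open>n ^ k\<close> both fit a word, so choosing the cheaper
  algorithm is a single comparison.\<close>

definition kov_prog :: "nat \<Rightarrow> prog" where
  "kov_prog k = Seq (prepare k) (Branch Le rTab rPow inclusion_exclusion brute_force)"

subsection \<open>Correctness of the program\<close>

text \<open>\<open>vec\<close> is indexed by the flat vector number, which separates the analysis of
  the program from the sets in the instance.\<close>

locale kov =
  fixes k n d w :: nat and vec :: "nat \<Rightarrow> nat \<Rightarrow> bool"
  assumes k_pos: "k \<ge> 1" and n_pos: "n \<ge> 1"
    and fits: "2 + k * (n * d) + d + k * n + k * 2 ^ d + 2 * 2 ^ d + n ^ k * 2 ^ d + n ^ k < 2 ^ w"
begin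

definition input :: "state \<Rightarrow> bool" where
  "input s \<longleftrightarrow> (\<forall>v<k * n. \<forall>x<d. mem s (2 + v * d + x) = of_bool (vec v x))"

definition env :: "state \<Rightarrow> bool" where
  "env s \<longleftrightarrow> reg s rN = n \<and> reg s rD = d \<and> reg s rK = k \<and> reg s rOne = 1 \<and> reg s rTwo = 2 \<and>
     reg s rZero = 0 \<and> reg s rPow = n ^ k \<and> reg s rTab = 2 ^ d \<and> reg s rBlk = n * d \<and> input s"

lemma small:
  "1 < (2::nat) ^ w" "2 < (2::nat) ^ w" "k < 2 ^ w" "n < 2 ^ w" "d < 2 ^ w" "n ^ k < 2 ^ w"
  "n * d < 2 ^ w" "k * n < 2 ^ w" "2 * 2 ^ d < (2::nat) ^ w" "2 ^ d < (2::nat) ^ w"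
  "k * 2 ^ d < 2 ^ w" "n ^ k * 2 ^ d < 2 ^ w" "k * (n * d) < 2 ^ w"
  "2 + k * (n * d) + d < 2 ^ w" "2 + k * (n * d) + k * 2 ^ d + 2 * 2 ^ d < 2 ^ w"
proof -
  \<comment> \<open>Linear arithmetic treats these products as atoms, so their nonnegativity is
    supplied.\<close>
  note nonneg = le0[of "k * (n * d)"] le0[of "k * n"] le0[of "k * 2 ^ d"] le0[of "n ^ k * 2 ^ d"]
    le0[of "n ^ k"] le0[of "2 ^ d"]
  have "k * 1 \<le> k * 2 ^ d" by (intro mult_le_mono) auto
  moreover have "1 * n \<le> k * n" "1 * (n * d) \<le> k * (n * d)" using k_pos by (intro mult_le_mono1; simp)+
  moreover have "(1::nat) \<le> 2 ^ d" by simp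
  ultimately show "1 < (2::nat) ^ w" "2 < (2::nat) ^ w" "k < 2 ^ w" "n < 2 ^ w" "d < 2 ^ w" "n ^ k < 2 ^ w"
    "n * d < 2 ^ w" "k * n < 2 ^ w" "2 * 2 ^ d < (2::nat) ^ w" "2 ^ d < (2::nat) ^ w"
    "k * 2 ^ d < 2 ^ w" "n ^ k * 2 ^ d < 2 ^ w" "k * (n * d) < 2 ^ w"
    "2 + k * (n * d) + d < 2 ^ w" "2 + k * (n * d) + k * 2 ^ d + 2 * 2 ^ d < 2 ^ w"
    using fits nonneg by linarith+
qed

lemma prepare_wp:
  assumes "\<forall>r. reg s r = 0" "mem s 0 = n" "mem s 1 = d" "input s"
    and Q: "\<And>t s'. t \<le> 3 * k + 9 \<Longrightarrow> env s' \<Longrightarrow> mem s' = mem s \<Longrightarrow>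
      \<forall>r\<in>{rAns, rOuter, rEven, rOdd}. reg s' r = 0 \<Longrightarrow> Q t s'"
  shows "wp w (prepare k) Q s"
  unfolding prepare_def
  using assms(1-4) small
proof (simp add: wp_Const_exact word_op_val_exact,
    intro wp_While_counted[where m = k and c = 2 and I = "\<lambda>i s'.
     reg s' rN = n \<and> reg s' rD = d \<and> reg s' rK = k \<and> reg s' rOne = 1 \<and> reg s' rTwo = 2 \<and>
     reg s' rZero = 0 \<and> reg s' rPow = n ^ i \<and> reg s' rTab = 2 ^ d \<and> reg s' rBlk = n * d \<and>
     reg s' rI = i \<and> mem s' = mem s \<and> (\<forall>r\<in>{rAns, rOuter, rEven, rOdd}. reg s' r = 0)"], goal_cases)
  case 1
  then show ?case by simp
next
  case (2 i s')
  then show ?case by simp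
next
  case (3 i s')
  then have "i < k" by simp
  then have "n ^ Suc i \<le> n ^ k" using n_pos by (intro power_increasing) auto
  then have "n ^ i * n < 2 ^ w" "i + 1 < 2 ^ w" using small \<open>i < k\<close> by (auto simp: mult.commute)
  with 3 show ?case by (simp add: word_op_val_exact mult.commute)
next
  case (4 t s')
  \<comment> \<open>Eight instructions precede the loop.\<close>
  then have "Q (8 + t) s'" by (intro Q) (simp_all add: env_def input_def)
  then show ?case by (simp add: numeral_eq_Suc One_nat_def)
qed

section \<open>Correctness and cost of the exhaustive search\<close>

lemma brute_and_wp:
  assumes "env s" "reg s rProd = 1" "reg s rRest = c" "reg s rI = 0" "reg s rPtr = 2 + x"
    and "x < d" "c < n ^ k"
    and Q: "\<And>t s'. t \<le> k * 9 + 1 \<Longrightarrow> env s' \<Longrightarrow> \<forall>r\<in>{rAns, rOuter, rX, rFlag}. reg s' r = reg s r \<Longrightarrow>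
      reg s' rProd = of_bool (\<forall>i<k. vec (i * n + c div n ^ i mod n) x) \<Longrightarrow> Q t s'"
  shows "wp w brute_and Q s"
  unfolding brute_and_def
proof (rule wp_While_counted[where m = k and c = 8 and I = "\<lambda>i s'. env s' \<and>
    (\<forall>r\<in>{rAns, rOuter, rX, rFlag}. reg s' r = reg s r) \<and>
    reg s' rI = i \<and> reg s' rRest = c div n ^ i \<and> reg s' rPtr = 2 + i * (n * d) + x \<and>
    reg s' rProd = of_bool (\<forall>i'<i. vec (i' * n + c div n ^ i' mod n) x)"], goal_cases)
  case 1
  then show ?case using assms by simp
next
  case (2 i s')
  then show ?case by (simp add: env_def)
next
  case (3 i s')
  then have "i < k" by simp
  define j where "j = c div n ^ i mod n"
  have j: "j < n" unfolding j_def using n_pos by simp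
  have vi: "i * n + j < k * n"
  proof -
    have "Suc i * n \<le> k * n" using 3 by (intro mult_le_mono1) simp
    with j show ?thesis by simp
  qed
  have "j * d \<le> n * d" using j by simp
  moreover have "Suc i * (n * d) \<le> k * (n * d)" using 3 by (intro mult_le_mono1) simp
  \<comment> \<open>After the last family the pointer moves past the input by at most
    \<open>x\<close>; the summand \<open>d\<close> in \<open>fits\<close> allows for this.\<close>
  ultimately have b: "j * d < 2 ^ w" "j * d + (2 + i * (n * d) + x) < 2 ^ w"
    "2 + i * (n * d) + x + n * d < 2 ^ w" "i + 1 < 2 ^ w" "c div n ^ i < 2 ^ w"
    using small \<open>x < d\<close> \<open>c < n ^ k\<close> \<open>i < k\<close> div_le_dividend[of c "n ^ i"]
    unfolding mult_Suc by linarith+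
  \<comment> \<open>The pointer stands at coordinate \<open>x\<close> of vector 0 of family
    \<open>i\<close>; the offset \<open>j * d\<close> selects vector \<open>j\<close>.\<close>
  have a: "j * d + (2 + i * (n * d) + x) = 2 + (i * n + j) * d + x" by (simp add: algebra_simps)
  have m: "mem s' (j * d + (2 + i * (n * d) + x)) = of_bool (vec (i * n + j) x)"
    unfolding a using 3 vi \<open>x < d\<close> by (auto simp: env_def input_def)
  have "c div n ^ i div n = c div n ^ Suc i" by (simp add: div_mult2_eq[symmetric] mult.commute)
  with 3 b m show ?case using small(1)
    by (simp add: env_def input_def word_op_val_exact j_def[symmetric])
      (auto simp: j_def less_Suc_eq word_op_val_exact split: split_of_bool)
next
  case (4 t s')
  then show ?case by (intro Q) auto
qed

lemma brute_tuple_wp: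
  assumes "env s" "reg s rX = 0" "reg s rFlag = 1" "reg s rOuter = c" and c: "c < n ^ k"
    and Q: "\<And>t s'. t \<le> d * Suc (9 * k + 8) + 1 \<Longrightarrow> env s' \<Longrightarrow>
      \<forall>r\<in>{rAns, rOuter}. reg s' r = reg s r \<Longrightarrow>
      reg s' rFlag = of_bool (\<forall>x<d. \<exists>i<k. \<not> vec (i * n + c div n ^ i mod n) x) \<Longrightarrow> Q t s'"
  shows "wp w brute_tuple Q s"
  unfolding brute_tuple_def
proof (rule wp_While_counted[where m = d and c = "9 * k + 8" and I = "\<lambda>x s'. env s' \<and>
    (\<forall>r\<in>{rAns, rOuter}. reg s' r = reg s r) \<and> reg s' rX = x \<and>
    reg s' rFlag = of_bool (\<forall>x'<x. \<exists>i<k. \<not> vec (i * n + c div n ^ i mod n) x')"], goal_cases)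
  case 1
  then show ?case using assms by simp
next
  case (2 x s')
  then show ?case by (simp add: env_def)
next
  case (3 x s')
  have b: "2 + x < 2 ^ w" "x + 1 < 2 ^ w" "c < 2 ^ w"
    using small c 3 le0[of "k * (n * d)"] by linarith+
  have regs: "reg s' rOuter = c" "reg s' rZero = 0" "reg s' rTwo = 2" "reg s' rX = x"
    using 3 assms by (auto simp: env_def)
  \<comment> \<open>The simplifier runs the code up to the inner loop, whose lemma takes the
    remaining code as its postcondition. The same pattern serves all nested loops.\<close>
  show ?case
    using small(1) b
    apply (simp add: wp_Const_exact word_op_val_exact regs)
    apply (rule brute_and_wp[where c = c and x = x])
    using 3 c apply (simp_all add: regs)
     apply (simp add: env_def input_def)
    apply (auto simp: wp_Const_exact word_op_val_exact b env_def input_def less_Suc_eq split: split_of_bool)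
    done
next
  case (4 t s')
  then show ?case by (intro Q) auto
qed

lemma brute_force_wp:
  assumes "env s" "reg s rOuter = 0" "reg s rAns = 0"
    and Q: "\<And>t s'. t \<le> n ^ k * Suc (d * Suc (9 * k + 8) + 6) + 1 \<Longrightarrow>
      reg s' rAns = of_bool (\<exists>c<n ^ k. \<forall>x<d. \<exists>i<k. \<not> vec (i * n + c div n ^ i mod n) x) \<Longrightarrow> Q t s'"
  shows "wp w brute_force Q s"
  unfolding brute_force_def
proof (rule wp_While_counted[where m = "n ^ k" and c = "d * Suc (9 * k + 8) + 6" and I = "\<lambda>c s'. env s' \<and>
    reg s' rOuter = c \<and>
    reg s' rAns = of_bool (\<exists>c'<c. \<forall>x<d. \<exists>i<k. \<not> vec (i * n + c' div n ^ i mod n) x)"], goal_cases)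
  case 1
  then show ?case using assms by simp
next
  case (2 x s')
  then show ?case by (simp add: env_def)
next
  case (3 c s')
  have b: "c + 1 < 2 ^ w" using small 3 by linarith
  show ?case
    using small(1)
    apply (simp add: wp_Const_exact)
    apply (rule brute_tuple_wp[where c = c])
    using 3 apply simp_all
     apply (simp add: env_def input_def)
    apply (auto simp: wp_Const_exact word_op_val_exact b env_def input_def less_Suc_eq split: split_of_bool)
    done
next
  case (4 t s')
  then show ?case by (intro Q) auto
qed

section \<open>Correctness and cost of the superset tables\<close>

definition tabled :: "state \<Rightarrow> bool" where
  "tabled s \<longleftrightarrow> env s \<and> reg s rBase = 2 + k * (n * d) \<and> reg s rSize = k * 2 ^ d \<and> reg s rVecs = k * n"

definition vec_code :: "nat \<Rightarrow> nat" where
  "vec_code v = v div n * 2 ^ d + bits_val (vec v) d"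

definition table :: "nat \<Rightarrow> nat \<Rightarrow> state \<Rightarrow> bool" where
  "table V x s \<longleftrightarrow>
     (\<forall>T<k * 2 ^ d. mem s (2 + k * (n * d) + T) = dominating vec_code V x T)"

lemma vec_code_less: "v < k * n \<Longrightarrow> vec_code v < k * 2 ^ d"
proof -
  assume "v < k * n"
  then have "Suc (v div n) \<le> k" using n_pos by (simp add: Suc_le_eq div_less_iff_less_mult)
  then have "Suc (v div n) * 2 ^ d \<le> k * 2 ^ d" by (rule mult_le_mono1)
  then show ?thesis using bits_val_less[of "vec v" d] by (simp add: vec_code_def)
qed

lemma vec_cell_less: "v < k * n \<Longrightarrow> x < d \<Longrightarrow> v * d + x < k * (n * d)"
proof -
  assume "v < k * n" "x < d"
  then have "Suc v * d \<le> k * n * d" by (intro mult_le_mono1) simp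
  with \<open>x < d\<close> show ?thesis by (simp add: mult.assoc)
qed

lemma input_reg [simp]: "input (s\<lparr>reg := r\<rparr>) \<longleftrightarrow> input s"
  by (simp add: input_def)

lemma table_reg [simp]: "table V x (s\<lparr>reg := r\<rparr>) \<longleftrightarrow> table V x s"
  by (simp add: table_def)

text \<open>The tables lie behind the input, so writing to them never damages a vector.\<close>

lemma input_store:
  "input s \<Longrightarrow> input (s\<lparr>mem := (mem s)(2 + k * (n * d) + T := z)\<rparr>)"
proof -
  have "2 + v * d + x \<noteq> 2 + k * (n * d) + T" if "v < k * n" "x < d" for v x
    using vec_cell_less[OF that] by linarith
  then show "input s \<Longrightarrow> ?thesis" by (simp add: input_def)
qed

lemma read_vector_wp:
  assumes "tabled s" "reg s rX = 0" "reg s rBit = 1" "reg s rPtr = 2 + v * d"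
    "reg s rProd = v div n * 2 ^ d" and v: "v < k * n"
    and Q: "\<And>t s'. t \<le> d * Suc 6 + 1 \<Longrightarrow> tabled s' \<Longrightarrow> mem s' = mem s \<Longrightarrow>
      \<forall>r\<in>{rAns, rOuter, rEven, rOdd}. reg s' r = reg s r \<Longrightarrow>
      reg s' rPtr = 2 + v * d + d \<Longrightarrow> reg s' rProd = vec_code v \<Longrightarrow> Q t s'"
  shows "wp w read_vector Q s"
  unfolding read_vector_def
proof (rule wp_While_counted[where m = d and c = 6 and I = "\<lambda>x s'. tabled s' \<and> mem s' = mem s \<and>
    (\<forall>r\<in>{rAns, rOuter, rEven, rOdd}. reg s' r = reg s r) \<and>
    reg s' rX = x \<and> reg s' rBit = 2 ^ x \<and> reg s' rPtr = 2 + v * d + x \<and>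
    reg s' rProd = v div n * 2 ^ d + bits_val (vec v) x"], goal_cases)
  case 1
  then show ?case using assms by simp
next
  case (2 x s')
  then show ?case by (simp add: tabled_def env_def)
next
  case (3 x s')
  then have "x < d" by simp
  \<comment> \<open>A partially read code stays below the next multiple of \<open>2 ^ d\<close>,
    hence inside the combined table's index range.\<close>
  have "bits_val (vec v) (Suc x) < 2 ^ Suc x" by (rule bits_val_less)
  also have le: "(2::nat) ^ Suc x \<le> 2 ^ d" using \<open>x < d\<close> by (intro power_increasing) auto
  finally have "v div n * 2 ^ d + bits_val (vec v) (Suc x) < Suc (v div n) * 2 ^ d" by simp
  also have "Suc (v div n) \<le> k"
    using v n_pos by (simp add: Suc_le_eq div_less_iff_less_mult)
  then have "Suc (v div n) * 2 ^ d \<le> k * 2 ^ d" by (rule mult_le_mono1)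
  finally have b: "v div n * 2 ^ d + bits_val (vec v) x + of_bool (vec v x) * 2 ^ x < 2 ^ w"
    using small by (simp add: bits_val_Suc add.assoc)
  then have b': "of_bool (vec v x) * 2 ^ x < (2::nat) ^ w" by linarith
  have b'': "(2::nat) ^ x * 2 < 2 ^ w"
    using le small(10) unfolding power_Suc by (simp only: mult.commute)
  have b3: "2 + v * d + x + 1 < 2 ^ w" "x + 1 < 2 ^ w"
    using small vec_cell_less[OF v \<open>x < d\<close>] \<open>x < d\<close> by linarith+
  have m: "mem s' (2 + v * d + x) = of_bool (vec v x)"
    using 3 v by (auto simp: tabled_def env_def input_def)
  show ?case
    using 3 b b' b'' b3 m
    by (auto simp: word_op_val_exact tabled_def env_def bits_val_Suc mult.commute)
next
  case (4 t s')
  then show ?case by (intro Q) (auto simp: vec_code_def)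
qed

lemma histogram_wp:
  assumes "tabled s" "reg s rOuter = 0" "reg s rPtr = 2" "table 0 0 s"
    and Q: "\<And>t s'. t \<le> k * n * Suc (7 * d + 10) + 1 \<Longrightarrow> tabled s' \<Longrightarrow>
      \<forall>r\<in>{rAns, rEven, rOdd}. reg s' r = reg s r \<Longrightarrow> table (k * n) 0 s' \<Longrightarrow> Q t s'"
  shows "wp w histogram Q s"
  unfolding histogram_def
proof (rule wp_While_counted[where m = "k * n" and c = "7 * d + 10" and I = "\<lambda>v s'. tabled s' \<and>
    (\<forall>r\<in>{rAns, rEven, rOdd}. reg s' r = reg s r) \<and>
    reg s' rOuter = v \<and> reg s' rPtr = 2 + v * d \<and> table v 0 s'"], goal_cases)
  case 1
  then show ?case using assms by simp
next
  case (2 v s')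
  then show ?case by (simp add: tabled_def)
next
  case (3 v s1)
  then have v: "v < k * n" by simp
  have "v div n < k" using v n_pos by (simp add: div_less_iff_less_mult)
  then have "v div n * 2 ^ d \<le> k * 2 ^ d" by (intro mult_le_mono1) simp
  then have b: "v div n * 2 ^ d < 2 ^ w" "v < 2 ^ w" "v + 1 < 2 ^ w"
    "vec_code v + (2 + k * (n * d)) < 2 ^ w"
    using small vec_code_less[OF v] v by linarith+
  \<comment> \<open>A counter never exceeds the number of vectors read so far.\<close>
  have c: "dominating vec_code v 0 T + 1 < 2 ^ w" for T
    using dominating_le[of vec_code v 0 T] b by linarith
  have regs: "reg s1 rOuter = v" "reg s1 rN = n" "reg s1 rTab = 2 ^ d"
    using 3 by (auto simp: tabled_def env_def)
  have fin: "mem s2 (2 + k * (n * d) + vec_code v) = dominating vec_code v 0 (vec_code v)"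
      "table (Suc v) 0 (s2\<lparr>mem := (mem s2)(2 + k * (n * d) + vec_code v :=
        dominating vec_code v 0 (vec_code v) + 1)\<rparr>)"
      "input (s2\<lparr>mem := (mem s2)(2 + k * (n * d) + vec_code v :=
        dominating vec_code v 0 (vec_code v) + 1)\<rparr>)"
    if s2: "tabled s2" "mem s2 = mem s1" for s2
  proof -
    have tab: "table v 0 s2" using 3 s2(2) by (simp add: table_def)
    then show "mem s2 (2 + k * (n * d) + vec_code v) = dominating vec_code v 0 (vec_code v)"
      using vec_code_less[OF v] by (simp add: table_def)
    show "table (Suc v) 0 (s2\<lparr>mem := (mem s2)(2 + k * (n * d) + vec_code v :=
        dominating vec_code v 0 (vec_code v) + 1)\<rparr>)"
      using tab by (auto simp: table_def dominating_0_Suc)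
    show "input (s2\<lparr>mem := (mem s2)(2 + k * (n * d) + vec_code v :=
        dominating vec_code v 0 (vec_code v) + 1)\<rparr>)"
      using s2(1) by (intro input_store) (simp add: tabled_def env_def)
  qed
  show ?case
    using small(1) b
    apply (simp add: wp_Const_exact word_op_val_exact regs)
    apply (rule read_vector_wp[where v = v])
    using 3 v apply (simp_all add: regs)
     apply (simp add: tabled_def env_def)
    subgoal for t s2
      using fin[of s2] c[of "vec_code v"]
      by (simp add: word_op_val_exact tabled_def env_def table_def input_def add.commute
          add.left_commute)
    done
next
  case (4 t s')
  then show ?case by (intro Q) auto
qed

text \<open>One table suffices because cells are visited in ascending order: the partner
  \<open>T + 2 ^ x\<close> lies ahead of \<open>T\<close> and still holds its value from round
  \<open>x\<close>. The invariant therefore has the cells below \<open>T\<close> at round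
  \<open>Suc x\<close> and all others at round \<open>x\<close>.\<close>

lemma zeta_step_wp:
  assumes "tabled s" "reg s rOuter = 0" "reg s rBit = 2 ^ x" "x < d" "table (k * n) x s"
    and Q: "\<And>t s'. t \<le> k * 2 ^ d * Suc 10 + 1 \<Longrightarrow> tabled s' \<Longrightarrow>
      \<forall>r\<in>{rAns, rEven, rOdd, rX, rBit}. reg s' r = reg s r \<Longrightarrow> table (k * n) (Suc x) s' \<Longrightarrow> Q t s'"
  shows "wp w zeta_step Q s"
  unfolding zeta_step_def
proof (rule wp_While_counted[where m = "k * 2 ^ d" and c = 10 and I = "\<lambda>T s'. tabled s' \<and>
    (\<forall>r\<in>{rAns, rEven, rOdd, rX, rBit}. reg s' r = reg s r) \<and> reg s' rOuter = T \<and>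
    (\<forall>U<k * 2 ^ d. mem s' (2 + k * (n * d) + U) =
       (if U < T then dominating vec_code (k * n) (Suc x) U else dominating vec_code (k * n) x U))"],
    goal_cases)
  case 1
  then show ?case using assms by (simp add: table_def)
next
  case (2 T s')
  then show ?case by (simp add: tabled_def)
next
  case (3 T s1)
  then have T: "T < k * 2 ^ d" by simp
  have "(2::nat) ^ x \<le> 2 ^ d" using \<open>x < d\<close> by (intro power_increasing) auto
  then have b: "T < 2 ^ w" "T + 1 < 2 ^ w" "T div 2 ^ x < 2 ^ w" "T + (2 + k * (n * d)) < 2 ^ w"
    "T + (2 + k * (n * d)) + 2 ^ x < 2 ^ w"
    using small T div_le_dividend[of T "2 ^ x"] by linarith+
  have regs: "reg s1 rOuter = T" "reg s1 rBit = 2 ^ x" "reg s1 rTwo = 2" "reg s1 rZero = 0"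
    "reg s1 rBase = 2 + k * (n * d)"
    using 3 assms(3) by (auto simp: tabled_def env_def)
  have bit: "T div 2 ^ x mod 2 = 0 \<longleftrightarrow> \<not> bit T x" by (simp add: bit_iff_odd even_iff_mod_2_eq_zero)
  show ?case
  proof (cases "bit T x")
    case True
    then have "dominating vec_code (k * n) (Suc x) T = dominating vec_code (k * n) x T"
      by (simp add: dominating_Suc)
    then show ?thesis
      using 3 b bit True
      by (auto simp: word_op_val_exact regs tabled_def env_def less_Suc_eq)
  next
    case False
    have "mem s1 (2 + k * (n * d) + U) =
       (if U < T then dominating vec_code (k * n) (Suc x) U else dominating vec_code (k * n) x U)"
      if "U < k * 2 ^ d" for U using 3 that by blast
    from this[OF T] this[OF add_two_power_less[OF T \<open>x < d\<close> False]]
    have m: "mem s1 (T + (2 + k * (n * d))) = dominating vec_code (k * n) x T"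
      "mem s1 (T + (2 + k * (n * d)) + 2 ^ x) = dominating vec_code (k * n) x (T + 2 ^ x)"
      by (simp_all add: ac_simps)
    have e: "dominating vec_code (k * n) x T + dominating vec_code (k * n) x (T + 2 ^ x)
        = dominating vec_code (k * n) (Suc x) T"
      using False by (simp add: dominating_Suc)
    have le: "dominating vec_code (k * n) (Suc x) T < 2 ^ w"
      using dominating_le[of vec_code "k * n" "Suc x" T] small by linarith
    have i: "input (s1\<lparr>mem := (mem s1)(T + (2 + k * (n * d)) := z)\<rparr>)" for z
      using input_store[of s1 T] 3 by (simp add: tabled_def env_def add.commute)
    show ?thesis
      using 3 b bit False m e le i[of "dominating vec_code (k * n) (Suc x) T"]
      by (auto simp: word_op_val_exact regs tabled_def env_def input_def less_Suc_eq)
  qed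
next
  case (4 t s')
  then show ?case by (intro Q) (auto simp: table_def)
qed

lemma zeta_wp:
  assumes "tabled s" "reg s rX = 0" "reg s rBit = 1" "table (k * n) 0 s"
    and Q: "\<And>t s'. t \<le> d * Suc (11 * (k * 2 ^ d) + 4) + 1 \<Longrightarrow> tabled s' \<Longrightarrow>
      \<forall>r\<in>{rAns, rEven, rOdd}. reg s' r = reg s r \<Longrightarrow> table (k * n) d s' \<Longrightarrow> Q t s'"
  shows "wp w zeta Q s"
  unfolding zeta_def
proof (rule wp_While_counted[where m = d and c = "11 * (k * 2 ^ d) + 4" and I = "\<lambda>x s'. tabled s' \<and>
    (\<forall>r\<in>{rAns, rEven, rOdd}. reg s' r = reg s r) \<and> reg s' rX = x \<and> reg s' rBit = 2 ^ x \<and>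
    table (k * n) x s'"], goal_cases)
  case 1
  then show ?case using assms by simp
next
  case (2 x s')
  then show ?case by (simp add: tabled_def env_def)
next
  case (3 x s1)
  have "(2::nat) ^ Suc x \<le> 2 ^ d" using 3 by (intro power_increasing) auto
  then have b: "(2::nat) ^ x * 2 < 2 ^ w" "x + 1 < 2 ^ w"
    using small 3 unfolding power_Suc by linarith+
  show ?case
    apply (simp add: wp_Const_exact)
    apply (rule zeta_step_wp[where x = x])
    using 3 apply (simp_all add: table_def)
     apply (simp add: tabled_def env_def)
    subgoal for t s2
      using b by (auto simp: word_op_val_exact tabled_def env_def mult.commute)
    done
next
  case (4 t s')
  then show ?case by (intro Q) auto
qed

section \<open>Evaluating the inclusion-exclusion sum\<close>

abbreviation freq :: "nat \<Rightarrow> nat \<Rightarrow> nat" where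
  "freq i S \<equiv> card {j. j < n \<and> (\<forall>x<d. bit S x \<longrightarrow> vec (i * n + j) x)}"

lemma freq_le: "freq i S \<le> n"
  by (rule order_trans[OF card_mono[of "{..<n}"]]) auto

lemma prod_freq_le: "(\<Prod>i<m. freq i S) \<le> n ^ m"
  using prod_mono[of "{..<m}" "\<lambda>i. freq i S" "\<lambda>_. n"] freq_le by simp

lemma table_freq:
  assumes "table (k * n) d s" "i < k" "S < 2 ^ d"
  shows "mem s (2 + k * (n * d) + S + i * 2 ^ d) = freq i S"
proof -
  have "Suc i * 2 ^ d \<le> k * 2 ^ d" using assms(2) by (intro mult_le_mono1) simp
  then have "i * 2 ^ d + S < k * 2 ^ d" using assms(3) by simp
  then have "mem s (2 + k * (n * d) + (i * 2 ^ d + S)) = dominating vec_code (k * n) d (i * 2 ^ d + S)"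
    using assms(1) by (simp add: table_def)
  also have "\<dots> = freq i S"
    by (rule dominating_card_supersets) (use assms vec_code_def in auto)
  finally show ?thesis by (simp add: ac_simps)
qed

lemma table_product_wp:
  assumes "tabled s" "reg s rI = 0" "reg s rProd = 1" "reg s rPtr = 2 + k * (n * d) + S" "S < 2 ^ d"
    "table (k * n) d s"
    and Q: "\<And>t s'. t \<le> k * Suc 4 + 1 \<Longrightarrow> tabled s' \<Longrightarrow> mem s' = mem s \<Longrightarrow>
      \<forall>r\<in>{rAns, rOuter, rEven, rOdd}. reg s' r = reg s r \<Longrightarrow>
      reg s' rProd = (\<Prod>i<k. freq i S) \<Longrightarrow> Q t s'"
  shows "wp w table_product Q s"
  unfolding table_product_def
proof (rule wp_While_counted[where m = k and c = 4 and I = "\<lambda>i s'. tabled s' \<and> mem s' = mem s \<and>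
    (\<forall>r\<in>{rAns, rOuter, rEven, rOdd}. reg s' r = reg s r) \<and> reg s' rI = i \<and>
    reg s' rPtr = 2 + k * (n * d) + S + i * 2 ^ d \<and> reg s' rProd = (\<Prod>i'<i. freq i' S)"], goal_cases)
  case 1
  then show ?case using assms by simp
next
  case (2 i s')
  then show ?case by (simp add: tabled_def env_def)
next
  case (3 i s1)
  have "Suc i * 2 ^ d \<le> k * 2 ^ d" using 3 by (intro mult_le_mono1) simp
  \<comment> \<open>After the last family the pointer passes the end of the tables by
    \<open>S < 2 ^ d\<close>; the slack in \<open>fits\<close> covers this.\<close>
  then have b: "2 + k * (n * d) + S + i * 2 ^ d + 2 ^ d < 2 ^ w" "i + 1 < 2 ^ w"
    using small 3 \<open>S < 2 ^ d\<close> unfolding mult_Suc by linarith+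
  have "n ^ Suc i \<le> n ^ k" using 3 n_pos by (intro power_increasing) auto
  then have p: "(\<Prod>i'<i. freq i' S) * freq i S < 2 ^ w"
    using prod_freq_le[of S "Suc i"] small by simp
  have m: "mem s1 (2 + k * (n * d) + S + i * 2 ^ d) = freq i S"
    using 3 assms by (intro table_freq) (auto simp: table_def)
  show ?case
    using 3 b p m by (simp add: word_op_val_exact tabled_def env_def add.commute add.left_commute)
next
  case (4 t s')
  then show ?case by (intro Q) auto
qed

lemma parity_wp:
  assumes "tabled s" "reg s rX = 0" "reg s rFlag = 0" "reg s rRest = S" "S < 2 ^ d"
    and Q: "\<And>t s'. t \<le> d * Suc 4 + 1 \<Longrightarrow> tabled s' \<Longrightarrow> mem s' = mem s \<Longrightarrow>
      \<forall>r\<in>{rAns, rOuter, rEven, rOdd, rProd}. reg s' r = reg s r \<Longrightarrow>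
      reg s' rFlag = (\<Sum>x<d. S div 2 ^ x) mod 2 \<Longrightarrow> Q t s'"
  shows "wp w parity Q s"
  unfolding parity_def
proof (rule wp_While_counted[where m = d and c = 4 and I = "\<lambda>x s'. tabled s' \<and> mem s' = mem s \<and>
    (\<forall>r\<in>{rAns, rOuter, rEven, rOdd, rProd}. reg s' r = reg s r) \<and> reg s' rX = x \<and>
    reg s' rRest = S div 2 ^ x \<and> reg s' rFlag = (\<Sum>x'<x. S div 2 ^ x') mod 2"], goal_cases)
  case 1
  then show ?case using assms by simp
next
  case (2 x s')
  then show ?case by (simp add: tabled_def env_def)
next
  case (3 x s1)
  have m: "(\<Sum>x'<x. S div 2 ^ x') mod 2 < 2" by simp
  have b: "(\<Sum>x'<x. S div 2 ^ x') mod 2 + S div 2 ^ x < 2 ^ w" "S div 2 ^ x < 2 ^ w" "x + 1 < 2 ^ w"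
    using small 3 \<open>S < 2 ^ d\<close> m div_le_dividend[of S "2 ^ x"] by linarith+
  have e: "S div 2 ^ x div 2 = S div 2 ^ Suc x"
    by (simp add: div_mult2_eq[symmetric] mult.commute)
  show ?case
    using 3 b e by (simp add: word_op_val_exact tabled_def env_def mod_add_left_eq)
next
  case (4 t s')
  then show ?case by (intro Q) auto
qed

definition signed_part :: "bool \<Rightarrow> nat \<Rightarrow> nat" where
  "signed_part b m = (\<Sum>S<m. if even (\<Sum>x<d. S div 2 ^ x) = b then \<Prod>i<k. freq i S else 0)"

lemma signed_part_le: "signed_part b m \<le> m * n ^ k"
proof -
  have "signed_part b m \<le> (\<Sum>S<m. n ^ k)"
    unfolding signed_part_def by (rule sum_mono) (auto intro: prod_freq_le)
  then show ?thesis by simp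
qed

text \<open>\<open>parity_sum_shifts\<close> turns the program's parity test into the sign
  \<open>(-1) ^ |S|\<close>, which matches the two sums with
  \<open>inclusion_exclusion_tuples\<close>.\<close>

lemma signed_part_diff:
  "int (signed_part True (2 ^ d)) - int (signed_part False (2 ^ d)) =
    int (card {f \<in> {..<k} \<rightarrow>\<^sub>E {..<n}. \<forall>x<d. \<exists>i<k. \<not> vec (i * n + f i) x})"
proof -
  have "int (signed_part True (2 ^ d)) - int (signed_part False (2 ^ d)) =
      (\<Sum>S<2 ^ d. (\<Prod>x<d. if bit S x then - 1 else 1) * (\<Prod>i<k. int (freq i S)))"
    unfolding signed_part_def of_nat_sum sum_subtractf[symmetric] parity_sum_shifts[symmetric]
    by (rule sum.cong) auto
  also note inclusion_exclusion_tuples[where b = "\<lambda>i j x. vec (i * n + j) x"]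
  finally show ?thesis .
qed

lemma signed_sums_wp:
  assumes "tabled s" "reg s rOuter = 0" "reg s rEven = 0" "reg s rOdd = 0" "table (k * n) d s"
    and Q: "\<And>t s'. t \<le> 2 ^ d * Suc (5 * k + 5 * d + 11) + 1 \<Longrightarrow> reg s' rAns = reg s rAns \<Longrightarrow>
      reg s' rEven = signed_part True (2 ^ d) \<Longrightarrow> reg s' rOdd = signed_part False (2 ^ d) \<Longrightarrow> Q t s'"
  shows "wp w signed_sums Q s"
  unfolding signed_sums_def
proof (rule wp_While_counted[where m = "2 ^ d" and c = "5 * k + 5 * d + 11" and I = "\<lambda>S s'. tabled s' \<and>
    mem s' = mem s \<and> reg s' rAns = reg s rAns \<and> reg s' rOuter = S \<and>
    reg s' rEven = signed_part True S \<and> reg s' rOdd = signed_part False S"], goal_cases)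
  case 1
  then show ?case using assms by (simp add: signed_part_def)
next
  case (2 S s')
  then show ?case by (simp add: tabled_def env_def)
next
  case (3 S s1)
  then have S: "S < 2 ^ d" by simp
  have b: "S < 2 ^ w" "S + 1 < 2 ^ w" "2 + k * (n * d) + S < 2 ^ w"
    using small S le0[of "k * 2 ^ d"] by linarith+
  have sp: "signed_part b (Suc S) = signed_part b S +
      (if even (\<Sum>x<d. S div 2 ^ x) = b then \<Prod>i<k. freq i S else 0)" for b
    by (simp add: signed_part_def)
  \<comment> \<open>Each \<open>S\<close> contributes at most \<open>n ^ k\<close>; the term
    \<open>n ^ k * 2 ^ d\<close> in \<open>fits\<close> leaves room for the sums.\<close>
  have "Suc S * n ^ k \<le> 2 ^ d * n ^ k" using S by (intro mult_le_mono1) simp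
  then have c: "signed_part b (Suc S) < 2 ^ w" for b
    using signed_part_le[of b "Suc S"] small by (simp only: mult.commute)
  have regs: "reg s1 rOuter = S" "reg s1 rBase = 2 + k * (n * d)" "reg s1 rZero = 0"
    using 3 by (auto simp: tabled_def env_def)
  have tab: "table (k * n) d s1" using 3 assms by (simp add: table_def)
  have zero: "reg s' rZero = 0" if "tabled s'" for s' using that by (simp add: tabled_def env_def)
  show ?case
    using small(1) b
    apply (simp add: wp_Const_exact word_op_val_exact regs del: wp_Branch)
    apply (rule table_product_wp[where S = S])
    using 3 S tab apply (simp_all add: regs del: wp_Branch)
     apply (simp add: tabled_def env_def)
    apply (simp add: zero word_op_val_exact wp_Const_exact del: wp_Branch)
    apply (rule parity_wp[where S = S])
          apply (simp_all add: zero del: wp_Branch)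
     apply (simp add: tabled_def env_def)
    using c[of True] c[of False] unfolding sp
    apply (cases "even (\<Sum>x<d. S div 2 ^ x)")
     apply (simp_all add: word_op_val_exact tabled_def env_def even_iff_mod_2_eq_zero)
    done
next
  case (4 t s')
  then show ?case by (intro Q) auto
qed

section \<open>Combining both algorithms\<close>

definition orthogonal_tuple :: bool where
  "orthogonal_tuple \<longleftrightarrow> (\<exists>f. (\<forall>i<k. f i < n) \<and> (\<forall>x<d. \<exists>i<k. \<not> vec (i * n + f i) x))"

lemma orthogonal_tuple_digits:
  "orthogonal_tuple \<longleftrightarrow> (\<exists>c<n ^ k. \<forall>x<d. \<exists>i<k. \<not> vec (i * n + c div n ^ i mod n) x)"
proof
  assume orthogonal_tuple
  then obtain f where f: "\<forall>i<k. f i < n" "\<forall>x<d. \<exists>i<k. \<not> vec (i * n + f i) x"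
    by (auto simp: orthogonal_tuple_def)
  obtain c where "c < n ^ k" "\<forall>i<k. c div n ^ i mod n = f i" using digits_surj[OF f(1)] by blast
  with f(2) show "\<exists>c<n ^ k. \<forall>x<d. \<exists>i<k. \<not> vec (i * n + c div n ^ i mod n) x" by metis
next
  assume "\<exists>c<n ^ k. \<forall>x<d. \<exists>i<k. \<not> vec (i * n + c div n ^ i mod n) x"
  then obtain c where "\<forall>x<d. \<exists>i<k. \<not> vec (i * n + c div n ^ i mod n) x" by blast
  then show orthogonal_tuple
    unfolding orthogonal_tuple_def using n_pos by (intro exI[of _ "\<lambda>i. c div n ^ i mod n"]) simp
qed

text \<open>The difference of the two sums is exactly the number of orthogonal tuples, so the sums
  agree only if there is none.\<close>

lemma orthogonal_tuple_signed:
  "orthogonal_tuple \<longleftrightarrow> signed_part True (2 ^ d) \<noteq> signed_part False (2 ^ d)"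
proof -
  let ?F = "{f \<in> {..<k} \<rightarrow>\<^sub>E {..<n}. \<forall>x<d. \<exists>i<k. \<not> vec (i * n + f i) x}"
  have "finite ?F" by (intro finite_Collect_conjI disjI1) (auto intro!: finite_PiE)
  then have "card ?F = 0 \<longleftrightarrow> ?F = {}" by (rule card_0_eq)
  moreover have "?F = {} \<longleftrightarrow> \<not> orthogonal_tuple"
  proof
    assume "\<not> orthogonal_tuple"
    moreover have orthogonal_tuple if "f \<in> ?F" for f
      unfolding orthogonal_tuple_def using that by (intro exI[of _ f]) auto
    ultimately show "?F = {}" by blast
  next
    assume F: "?F = {}"
    show "\<not> orthogonal_tuple"
    proof
      assume orthogonal_tuple
      then obtain f where "\<forall>i<k. f i < n" "\<forall>x<d. \<exists>i<k. \<not> vec (i * n + f i) x"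
        by (auto simp: orthogonal_tuple_def)
      \<comment> \<open>Members of the extensional function space are \<open>undefined\<close>
        outside \<open>{..<k}\<close>.\<close>
      then have "restrict f {..<k} \<in> ?F" by auto
      with F show False by blast
    qed
  qed
  ultimately show ?thesis using signed_part_diff by auto
qed

text \<open>The constant 13 consists of at most ten units outside the loops and the three final loop
  tests.\<close>

lemma inclusion_exclusion_wp:
  assumes "env s" "\<forall>r\<in>{rAns, rOuter, rEven, rOdd}. reg s r = 0"
    and mem: "\<And>a. 2 + k * (n * d) \<le> a \<Longrightarrow> mem s a = 0"
    and Q: "\<And>t s'. t \<le> 13 + k * n * Suc (7 * d + 10) + d * Suc (11 * (k * 2 ^ d) + 4) +
      2 ^ d * Suc (5 * k + 5 * d + 11) \<Longrightarrow> reg s' rAns = of_bool orthogonal_tuple \<Longrightarrow> Q t s'"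
  shows "wp w inclusion_exclusion Q s"
proof -
  have regs: "reg s rN = n" "reg s rK = k" "reg s rTwo = 2" "reg s rZero = 0" "reg s rTab = 2 ^ d"
    "reg s rBlk = n * d" "reg s rOuter = 0"
    using assms by (auto simp: env_def)
  \<comment> \<open>Untouched memory is zero, which is the histogram of no vectors, so the tables
    need no initialisation.\<close>
  have tab: "table 0 0 s" using mem by (simp add: table_def dominating_0)
  have b: "k * (n * d) + 2 < 2 ^ w" using small by linarith
  show ?thesis
    unfolding inclusion_exclusion_def
    using small b
    apply (simp add: word_op_val_exact regs del: wp_Branch)
    apply (rule histogram_wp)
        apply (use assms(1) in \<open>simp add: tabled_def env_def\<close>)
       apply (simp add: regs)
      apply simp
     apply (use tab in \<open>simp add: table_def\<close>)
    apply (simp add: wp_Const_exact del: wp_Branch)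
    apply (rule zeta_wp)
        apply (simp add: tabled_def env_def)
       apply simp
      apply simp
     apply (simp add: table_def)
    apply (simp add: wp_Const_exact del: wp_Branch)
    apply (rule signed_sums_wp)
         apply (simp add: tabled_def env_def)
        apply simp
       apply (use assms(2) in simp)
      apply (use assms(2) in simp)
     apply (simp add: table_def)
    apply (use assms(2) in \<open>simp add: wp_Const_exact\<close>)
    apply (auto intro!: Q simp: orthogonal_tuple_signed)
    done
qed

lemma kov_prog_wp:
  assumes "\<forall>r. reg s r = 0" "mem s 0 = n" "mem s 1 = d" "input s"
    and mem: "\<And>a. 2 + k * (n * d) \<le> a \<Longrightarrow> mem s a = 0"
    and Q: "\<And>t s'. t \<le> 100 * k * (d + 1) * (if 2 ^ d \<le> n ^ k then n + 2 ^ d else n ^ k) \<Longrightarrow>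
      reg s' rAns = of_bool orthogonal_tuple \<Longrightarrow> Q t s'"
  shows "wp w (kov_prog k) Q s"
  unfolding kov_prog_def wp_Seq
proof (rule prepare_wp[OF assms(1-4)], goal_cases)
  case (1 t s1)
  have regs: "reg s1 rTab = 2 ^ d" "reg s1 rPow = n ^ k" using 1 by (auto simp: env_def)
  have one: "1 \<le> k * (d + 1)" "k * 1 \<le> k * (d + 1)"
    using k_pos mult_le_mono[OF k_pos, of 1 "d + 1"] by auto
  show ?case
  proof (cases "(2::nat) ^ d \<le> n ^ k")
    case True
    show ?thesis
      unfolding wp_Branch regs using True
      apply simp
      apply (rule inclusion_exclusion_wp)
         apply (use 1 mem in auto)[3]
      subgoal premises prems for u s2
      proof (rule Q)
        define D where "D = (2::nat) ^ d"
        have D: "1 \<le> D" by (simp add: D_def)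
        \<comment> \<open>\<open>A\<close> pays for the histogram and the constant overhead,
          \<open>B\<close> for the transform and the signed sums; 100 is a generous common
          factor.\<close>
        define A where "A = k * (d + 1) * n"
        define B where "B = k * (d + 1) * D"
        have "k * (d + 1) * 1 \<le> A" unfolding A_def using n_pos by (intro mult_le_mono2)
        then have "1 \<le> A" "k \<le> A" using one by linarith+
        moreover have "k * n * Suc (7 * d + 10) \<le> 11 * A"
        proof -
          have "k * n * Suc (7 * d + 10) \<le> k * n * (11 * (d + 1))" by (intro mult_le_mono2) simp
          also have "\<dots> = 11 * A" by (simp only: A_def ac_simps)
          finally show ?thesis .
        qed
        moreover have "d * Suc (11 * (k * D) + 4) \<le> 16 * B"
        proof -
          have "d * Suc (11 * (k * D) + 4) \<le> (d + 1) * (16 * (k * D))"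
            using k_pos D by (intro mult_le_mono) (auto simp: Suc_le_eq)
          also have "\<dots> = 16 * B" by (simp only: B_def ac_simps)
          finally show ?thesis .
        qed
        moreover have "D * Suc (5 * k + 5 * d + 11) \<le> 22 * B"
        proof -
          have "D * Suc (5 * k + 5 * d + 11) \<le> D * (22 * (k * (d + 1)))"
            using k_pos mult_le_mono1[OF k_pos, of d]
            by (intro mult_le_mono2, unfold distrib_left) linarith
          also have "\<dots> = 22 * B" by (simp only: B_def ac_simps)
          finally show ?thesis .
        qed
        moreover have "u \<le> 13 + k * n * Suc (7 * d + 10) + d * Suc (11 * (k * D) + 4) +
            D * Suc (5 * k + 5 * d + 11)" using prems unfolding D_def by blast
        ultimately have "u \<le> 13 + 11 * A + 38 * B" by simp
        moreover have "t \<le> 3 * k + 9" by (rule 1)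
        ultimately have "Suc (t + u) \<le> 100 * (A + B)" using \<open>1 \<le> A\<close> \<open>k \<le> A\<close> by simp
        also have "A + B = k * (d + 1) * (n + D)" by (simp only: A_def B_def distrib_left)
        finally show "Suc (t + u) \<le> 100 * k * (d + 1) * (if 2 ^ d \<le> n ^ k then n + 2 ^ d else n ^ k)"
          using True by (simp add: D_def mult.assoc)
      qed (use prems in blast)
      done
  next
    case False
    show ?thesis
      unfolding wp_Branch regs using False
      apply simp
      apply (rule brute_force_wp)
         apply (use 1 in auto)[3]
      subgoal premises prems for u s2
      proof (rule Q)
        define N where "N = n ^ k"
        define A where "A = k * (d + 1) * N"
        have "k * (d + 1) * 1 \<le> A"
          unfolding A_def N_def using n_pos by (intro mult_le_mono2) simp
        moreover have "N * Suc (d * Suc (9 * k + 8) + 6) \<le> N * (25 * (k * (d + 1)))"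
          using k_pos mult_le_mono1[OF k_pos, of d] mult.left_commute[of d 9 k] mult.commute[of d k]
          by (intro mult_le_mono2, unfold distrib_left mult_Suc_right) linarith
        moreover have "N * (25 * (k * (d + 1))) = 25 * A" by (simp only: A_def ac_simps)
        moreover have "t \<le> 3 * k + 9" by (rule 1)
        moreover have "u \<le> N * Suc (d * Suc (9 * k + 8) + 6) + 1"
          using prems unfolding N_def by blast
        ultimately have "Suc (t + u) \<le> 100 * A" using one by linarith
        then show "Suc (t + u) \<le> 100 * k * (d + 1) * (if 2 ^ d \<le> n ^ k then n + 2 ^ d else n ^ k)"
          using False by (simp add: A_def N_def mult.assoc)
      qed (use prems orthogonal_tuple_digits in simp)
      done
  qed
qed

end

theorem theorem1p4:
  fixes k :: nat
  assumes "k \<ge> 2"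
  shows "\<exists>\<epsilon>::real. \<epsilon> > 0 \<and> (\<exists>P. \<forall>c::real. c > 0 \<longrightarrow>
    (\<exists>\<kappa>::real. \<exists>C::real. \<forall>(n::nat) (d::nat) (w::nat) As.
      n \<ge> 1 \<longrightarrow> \<bar>real d - c * log 2 (real n)\<bar> < 1 \<longrightarrow>
      real w \<ge> \<kappa> * log 2 (real n + 1) \<longrightarrow> kov_instance k n d As \<longrightarrow>
      decides_within w P (kov_encode n d As) (kov_yes As)
        (C * (2 powr ((1 - \<epsilon>) * real d) * real n))))"
proof (rule exI[of _ "1 / (2 * real k)"], intro conjI, goal_cases)
  case 1
  show "1 / (2 * real k) > 0" using assms by simp
next
  case 2
  show ?case
  proof (rule exI[of _ "kov_prog k"], intro allI impI)
    fix c :: real assume c: "c > 0"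
    show "\<exists>\<kappa> C. \<forall>n d w As. n \<ge> 1 \<longrightarrow> \<bar>real d - c * log 2 (real n)\<bar> < 1 \<longrightarrow>
        real w \<ge> \<kappa> * log 2 (real n + 1) \<longrightarrow> kov_instance k n d As \<longrightarrow>
        decides_within w (kov_prog k) (kov_encode n d As) (kov_yes As)
          (C * (2 powr ((1 - 1 / (2 * real k)) * real d) * real n))"
    \<comment> \<open>The witnesses are the word-length factor from \<open>word_fits\<close> and the
      constant from \<open>running_time_bound\<close>.\<close>
    proof (rule exI[of _ "2 * real k + c + 5"], rule exI[of _ "800 * real k ^ 2"], intro allI impI)
      fix n d w :: nat and As
      assume n: "1 \<le> n" and d: "\<bar>real d - c * log 2 (real n)\<bar> < 1"
        and w: "(2 * real k + c + 5) * log 2 (real n + 1) \<le> real w" and inst: "kov_instance k n d As"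
      have k: "1 \<le> k" using assms by simp
      define vec where "vec v x \<longleftrightarrow> Suc x \<in> As ! (v div n) ! (v mod n)" for v x
      interpret kov k n d w vec
        by unfold_locales (use k n word_fits[OF k n c d w] in auto)
      let ?s = "initial_state (kov_encode n d As)"
      have "vec (i * n + j) x \<longleftrightarrow> Suc x \<in> As ! i ! j" if "j < n" for i j x
        using that by (simp add: vec_def)
      then have yes: "orthogonal_tuple \<longleftrightarrow> kov_yes As"
        unfolding orthogonal_tuple_def kov_yes_index[OF inst k]
        by (intro arg_cong[where f = Ex] ext conj_cong refl) (metis (no_types, lifting))
      have "wp w (kov_prog k) (\<lambda>t s'.
          t \<le> 100 * k * (d + 1) * (if 2 ^ d \<le> n ^ k then n + 2 ^ d else n ^ k) \<and>
          reg s' 0 = of_bool orthogonal_tuple) ?s"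
      proof (rule kov_prog_wp)
        show "\<forall>r. reg ?s r = 0" "mem ?s 0 = n" "mem ?s 1 = d"
          by (simp_all add: initial_state_def kov_encode_def)
        show "input ?s" using kov_encode_initial(1)[OF inst] by (simp add: input_def vec_def)
        show "mem ?s a = 0" if "2 + k * (n * d) \<le> a" for a
          using kov_encode_initial(2)[OF inst that] .
      qed auto
      then obtain t s' where "exec w (kov_prog k) ?s t s'"
        "t \<le> 100 * k * (d + 1) * (if 2 ^ d \<le> n ^ k then n + 2 ^ d else n ^ k)"
        "reg s' 0 = of_bool orthogonal_tuple"
        unfolding wp_def by blast
      moreover from this(2) have "real t \<le>
          800 * real k ^ 2 * (2 powr ((1 - 1 / (2 * real k)) * real d) * real n)"
        using running_time_bound[OF k n, of d] by (meson of_nat_mono order_trans)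
      ultimately show "decides_within w (kov_prog k) (kov_encode n d As) (kov_yes As)
          (800 * real k ^ 2 * (2 powr ((1 - 1 / (2 * real k)) * real d) * real n))"
        unfolding decides_within_def using yes by (intro exI[of _ t] exI[of _ s']) (simp add: of_bool_def)
    qed
  qed
qed

end
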